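(* Let $\mathcal M$ and $\widetilde{\mathcal M}$ be two Hilbert modules in $\mathfrak B_1(\Omega^* )$ consisting of holomorphic functions on a bounded domain $\Omega\subset\mathbb C^m$. Assume that the dimension of the zero set of these modules is at most $m-2$. Suppose there exists a polynomial ideal $\mathcal I$ such that $\mathcal M$ and $\widetilde{\mathcal M}$ are the completions of $\mathcal I$ with respect to different inner products. Let $w_0\in Z(\mathcal M)$. If the modules $\mathcal M$ and $\widetilde{\mathcal M}$ are equivalent, then the corresponding bundles $\mathcal L_0(\mathcal M)$ and $\mathcal L_0(\widetilde{\mathcal M})$ they determine on the projective space $p^{-1}(w_0)^*$ are equivalent as Hermitian holomorphic line bundles.
   Context: $\Omega^*=\{\bar z:z\in\Omega\}$, $\mathbb C[\underline z]=\mathbb C[z_1,\ldots,z_m]$, and $\mathfrak m_w$ is the maximal ideal of $\mathbb C[\underline z]$ at $w$. Hilbert modules here are Hilbert spaces of holomorphic functions on $\Omega$ on which multiplication $M_j$ by each $z_j$ is bounded. $\mathcal M$ is in the class $\mathfrak B_1(\Omega^* )$ if it possesses a reproducing kernel $K$ (it is allowed that $K(w,w)=0$ on a closed subset of $\Omega$) and $\dim\mathcal M/\mathfrak m_w\mathcal M<\infty$ for all $w\in\Omega$. Its zero set is $Z(\mathcal M)=\{w\in\Omega: f(w)=0\ \forall f\in\mathcal M\}$. Two Hilbert modules are equivalent if there is a unitary operator between them intertwining multiplication by all polynomials. The analytic sheaf $\mathcal S^{\mathcal M}\subset\mathcal O_\Omega$ has stalk at $w$ the ideal of $\mathcal O_w$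 generated by the germs at $w$ of the functions in $\mathcal M$; for two completions $\mathcal M,\widetilde{\mathcal M}$ of the same ideal these stalks coincide. Let $K,\widetilde K$ be the reproducing kernels of $\mathcal M,\widetilde{\mathcal M}$. Fix $w_0\in Z(\mathcal M)$, put $t=\dim\mathcal S^{\mathcal M}_{w_0}/\mathfrak m_{w_0}\mathcal S^{\mathcal M}_{w_0}=\dim\bigcap_{j=1}^m\ker(M_j-w_{0j})^*$, and fix a minimal set of generators $g_1,\ldots,g_t$ of the common stalk at $w_0$. By a known decomposition theorem, for some polydisc $\Delta(w_0;r)\subset\Omega$, $r>0$, there are anti-holomorphic maps $w\mapsto K^{(j)}(\cdot,w)\in\mathcal M$ on $\Delta(w_0;r)$, $1\le j\le t$, linearly independent at each $w$, with $$K(\cdot,w)=\sum_{j=1}^t\overline{g_j(w)}\,K^{(j)}(\cdot,w),\qquad w\in\Delta(w_0;r),$$ and likewise $\widetilde K(\cdot,w)=\sum_j\overline{g_j(w)}\,\widetilde K^{(j)}(\cdot,w)$ in $\widetilde{\mathcal M}$ with the same $g_j$. The vectors $K^{(j)}(\cdot,w_0)$ (resp. $\widetilde K^{(j)}(\cdot,w_0)$) are uniquely determined by $g_1,\ldots,g_t$. The fibre over $w_0$ of the monoidal transform $p$ of $\Delta(w_0;r)$ along $g_1,\ldots,g_t$ is $p^{-1}(w_0)=\{w_0\}\times\mathbb P^{t-1}$; its points are $(w_0,\pi(u))$ with $\pi(u)=(u_1:\cdots:u_t)$, and $p^{-1}(w_0)^*=\{(\bar w_0,\pi(\bar u)):(w_0,\pi(u))\in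 p^{-1}(w_0)\}$. On the chart $\{u_i\neq0\}$ put $\theta^i_j=u_j/u_i$. $\mathcal L_0(\mathcal M)$ is the Hermitian holomorphic line bundle on $p^{-1}(w_0)^*$ whose fibre over the point corresponding to $(w_0,\pi(u))$ with $u_i\ne0$ is the line in $\mathcal M$ spanned by $$s_i(\theta)=K^{(i)}(\cdot,w_0)+\sum_{j\ne i}\overline{\theta^i_j}\,K^{(j)}(\cdot,w_0),$$ with the $s_i$ as local holomorphic frames (in the conjugate coordinates) and the metric induced by the norm of $\mathcal M$. $\mathcal L_0(\widetilde{\mathcal M})$ is defined in the same way from $\widetilde K^{(j)}(\cdot,w_0)$. Equivalence means an isometric holomorphic bundle isomorphism over the identity of the base. *)

theory Defs
  imports "HOL-Analysis.Analysis"
begin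

section \<open>Holomorphic functions of several variables and polynomials\<close>

definition holomorphic_mv :: "(complex^'m \<Rightarrow> complex) \<Rightarrow> (complex^'m) set \<Rightarrow> bool" where
  "holomorphic_mv f S \<longleftrightarrow>
     (\<forall>z\<in>S. \<exists>D. (f has_derivative D) (at z) \<and> (\<forall>c v. D (c *s v) = c * D v))"

definition holomorphic_map :: "(complex^'m \<Rightarrow> complex^'m) \<Rightarrow> (complex^'m) set \<Rightarrow> bool" where
  "holomorphic_map F S \<longleftrightarrow> (\<forall>i. holomorphic_mv (\<lambda>z. F z $ i) S)"

definition cnj_vec :: "complex^'n \<Rightarrow> complex^'n" where
  "cnj_vec u = (\<chi> i. cnj (u $ i))"

definition polydisc :: "complex^'m \<Rightarrow> real \<Rightarrow> (complex^'m) set" where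
  "polydisc w r = {z. \<forall>i. cmod (z $ i - w $ i) < r}"

text \<open>Polynomials are represented by the functions they induce on the whole space, which is
  faithful because the field is infinite.\<close>

inductive_set polyfuns :: "(complex^'m \<Rightarrow> complex) set" where
  const: "(\<lambda>z. c) \<in> polyfuns"
| coord: "(\<lambda>z. z $ i) \<in> polyfuns"
| add: "p \<in> polyfuns \<Longrightarrow> q \<in> polyfuns \<Longrightarrow> (\<lambda>z. p z + q z) \<in> polyfuns"
| mult: "p \<in> polyfuns \<Longrightarrow> q \<in> polyfuns \<Longrightarrow> (\<lambda>z. p z * q z) \<in> polyfuns"

definition poly_ideal :: "(complex^'m \<Rightarrow> complex) set \<Rightarrow> bool" where
  "poly_ideal I \<longleftrightarrow> I \<subseteq> polyfuns \<and> (\<lambda>z. 0) \<in> I \<and>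
     (\<forall>p\<in>I. \<forall>q\<in>I. (\<lambda>z. p z + q z) \<in> I) \<and>
     (\<forall>p\<in>polyfuns. \<forall>q\<in>I. (\<lambda>z. p z * q z) \<in> I)"

definition max_ideal :: "complex^'m \<Rightarrow> (complex^'m \<Rightarrow> complex) set" where
  "max_ideal w = {p \<in> polyfuns. p w = 0}"

definition max_ideal_times ::
    "complex^'m \<Rightarrow> (complex^'m \<Rightarrow> complex) set \<Rightarrow> (complex^'m \<Rightarrow> complex) set" where
  "max_ideal_times w V =
     {(\<lambda>z. \<Sum>k<N. p k z * f k z) | (N::nat) p f. \<forall>k<N. p k \<in> max_ideal w \<and> f k \<in> V}"

text \<open>The first \<open>d\<close> terms of \<open>b\<close> represent a basis of the complex vector space \<open>V/W\<close>.\<close>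

definition has_quotient_dim ::
    "('x \<Rightarrow> complex) set \<Rightarrow> ('x \<Rightarrow> complex) set \<Rightarrow> nat \<Rightarrow> bool" where
  "has_quotient_dim V W d \<longleftrightarrow> (\<exists>b::nat \<Rightarrow> 'x \<Rightarrow> complex.
     (\<forall>k<d. b k \<in> V) \<and>
     (\<forall>f\<in>V. \<exists>c::nat \<Rightarrow> complex. (\<lambda>z. f z - (\<Sum>k<d. c k * b k z)) \<in> W) \<and>
     (\<forall>c::nat \<Rightarrow> complex. (\<lambda>z. \<Sum>k<d. c k * b k z) \<in> W \<longrightarrow> (\<forall>k<d. c k = 0)))"

section \<open>Hilbert modules of holomorphic functions\<close>

text \<open>Functions on \<open>\<Omega>\<close> are represented by their extension by zero to the whole space. The
  inner product is linear in its first argument and is only meaningful on \<open>hcarrier\<close>.\<close>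

record ('m::finite) hmodule =
  hcarrier :: "(complex^'m \<Rightarrow> complex) set"
  hip :: "(complex^'m \<Rightarrow> complex) \<Rightarrow> (complex^'m \<Rightarrow> complex) \<Rightarrow> complex"

definition hnorm :: "('m::finite) hmodule \<Rightarrow> (complex^'m \<Rightarrow> complex) \<Rightarrow> real" where
  "hnorm M f = sqrt (Re (hip M f f))"

definition hilbert_function_space :: "(complex^'m) set \<Rightarrow> ('m::finite) hmodule \<Rightarrow> bool" where
  "hilbert_function_space \<Omega> M \<longleftrightarrow>
     (\<forall>f\<in>hcarrier M. holomorphic_mv f \<Omega> \<and> (\<forall>z. z \<notin> \<Omega> \<longrightarrow> f z = 0)) \<and>
     (\<lambda>z. 0) \<in> hcarrier M \<and>
     (\<forall>a b. \<forall>f\<in>hcarrier M. \<forall>g\<in>hcarrier M. (\<lambda>z. a * f z + b * g z) \<in> hcarrier M) \<and>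
     (\<forall>a b. \<forall>f\<in>hcarrier M. \<forall>g\<in>hcarrier M. \<forall>h\<in>hcarrier M.
        hip M (\<lambda>z. a * f z + b * g z) h = a * hip M f h + b * hip M g h) \<and>
     (\<forall>f\<in>hcarrier M. \<forall>g\<in>hcarrier M. hip M g f = cnj (hip M f g)) \<and>
     (\<forall>f\<in>hcarrier M. f \<noteq> (\<lambda>z. 0) \<longrightarrow> Re (hip M f f) > 0) \<and>
     (\<forall>X::nat \<Rightarrow> complex^'m \<Rightarrow> complex.
        (\<forall>n. X n \<in> hcarrier M) \<and>
        (\<forall>e>0. \<exists>N. \<forall>m\<ge>N. \<forall>n\<ge>N. hnorm M (\<lambda>z. X m z - X n z) < e) \<longrightarrow>
        (\<exists>f\<in>hcarrier M. (\<lambda>n. hnorm M (\<lambda>z. X n z - f z)) \<longlonglongrightarrow> 0))"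

definition hilbert_module :: "(complex^'m) set \<Rightarrow> ('m::finite) hmodule \<Rightarrow> bool" where
  "hilbert_module \<Omega> M \<longleftrightarrow> hilbert_function_space \<Omega> M \<and>
     (\<forall>j. (\<forall>f\<in>hcarrier M. (\<lambda>z. z $ j * f z) \<in> hcarrier M) \<and>
          (\<exists>C. \<forall>f\<in>hcarrier M. hnorm M (\<lambda>z. z $ j * f z) \<le> C * hnorm M f))"

definition reproducing_kernel ::
    "(complex^'m) set \<Rightarrow> ('m::finite) hmodule \<Rightarrow> (complex^'m \<Rightarrow> complex^'m \<Rightarrow> complex) \<Rightarrow> bool" where
  "reproducing_kernel \<Omega> M K \<longleftrightarrow>
     (\<forall>w\<in>\<Omega>. (\<lambda>z. K z w) \<in> hcarrier M \<and> (\<forall>f\<in>hcarrier M. hip M f (\<lambda>z. K z w) = f w))"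

text \<open>The class \<open>\<BB>\<^sub>1(\<Omega>\<^sup>*)\<close>; the conjugate domain enters its name only.\<close>

definition class_B1 :: "(complex^'m) set \<Rightarrow> ('m::finite) hmodule \<Rightarrow> bool" where
  "class_B1 \<Omega> M \<longleftrightarrow> hilbert_module \<Omega> M \<and> (\<exists>K. reproducing_kernel \<Omega> M K) \<and>
     (\<forall>w\<in>\<Omega>. \<exists>d. has_quotient_dim (hcarrier M) (max_ideal_times w (hcarrier M)) d)"

definition zero_set :: "(complex^'m) set \<Rightarrow> ('m::finite) hmodule \<Rightarrow> (complex^'m) set" where
  "zero_set \<Omega> M = {w\<in>\<Omega>. \<forall>f\<in>hcarrier M. f w = 0}"

text \<open>\<open>M\<close> is the completion of \<open>I\<close> in the inner product that \<open>I\<close> inherits from \<open>M\<close>.\<close>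

definition completion_of ::
    "(complex^'m) set \<Rightarrow> (complex^'m \<Rightarrow> complex) set \<Rightarrow> ('m::finite) hmodule \<Rightarrow> bool" where
  "completion_of \<Omega> I M \<longleftrightarrow>
     (\<forall>p\<in>I. (\<lambda>z. if z \<in> \<Omega> then p z else 0) \<in> hcarrier M) \<and>
     (\<forall>f\<in>hcarrier M. \<forall>e>0. \<exists>p\<in>I. hnorm M (\<lambda>z. f z - (if z \<in> \<Omega> then p z else 0)) < e)"

definition module_equivalent :: "('m::finite) hmodule \<Rightarrow> 'm hmodule \<Rightarrow> bool" where
  "module_equivalent M M' \<longleftrightarrow> (\<exists>U. bij_betw U (hcarrier M) (hcarrier M') \<and>
     (\<forall>a b. \<forall>f\<in>hcarrier M. \<forall>g\<in>hcarrier M.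
        U (\<lambda>z. a * f z + b * g z) = (\<lambda>z. a * U f z + b * U g z)) \<and>
     (\<forall>f\<in>hcarrier M. \<forall>g\<in>hcarrier M. hip M' (U f) (U g) = hip M f g) \<and>
     (\<forall>p\<in>polyfuns. \<forall>f\<in>hcarrier M. U (\<lambda>z. p z * f z) = (\<lambda>z. p z * U f z)))"

section \<open>Dimension of analytic sets\<close>

text \<open>Near \<open>a\<close>, the set \<open>A\<close> is a complex submanifold of dimension \<open>k\<close>: a biholomorphic change of
  coordinates \<open>\<phi>\<close> takes it to a coordinate plane. The dimension of an analytic set is its largest
  dimension at a regular point (by convention 0 for the empty set).\<close>

definition regular_point_of_dim :: "(complex^'m) set \<Rightarrow> nat \<Rightarrow> complex^'m \<Rightarrow> bool" where
  "regular_point_of_dim A k a \<longleftrightarrow> a \<in> A \<and>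
     (\<exists>U V \<phi> \<psi> S. open U \<and> a \<in> U \<and> open V \<and>
        holomorphic_map \<phi> U \<and> holomorphic_map \<psi> V \<and> \<phi> ` U = V \<and> \<psi> ` V = U \<and>
        (\<forall>z\<in>U. \<psi> (\<phi> z) = z) \<and> (\<forall>z\<in>V. \<phi> (\<psi> z) = z) \<and>
        card S = k \<and> \<phi> ` (A \<inter> U) = {z\<in>V. \<forall>i. i \<notin> S \<longrightarrow> z $ i = 0})"

definition analytic_dim :: "(complex^'m) set \<Rightarrow> nat" where
  "analytic_dim A = Sup {k. \<exists>a. regular_point_of_dim A k a}"

section \<open>Stalks\<close>

text \<open>Germs at \<open>w\<close> are represented by functions, equality of germs being eventual equality in
  \<open>nhds w\<close>. The sets of representatives below are closed under this equality. So is
  \<open>max_ideal_times w V\<close> if \<open>V\<close> is a stalk: a function \<open>e\<close> with zero germ vanishes at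
  \<open>w\<close> and is a sum of products \<open>(z\<^sub>j - w\<^sub>j) e\<^sub>j\<close> with \<open>e\<^sub>j\<close> of zero germ. Hence \<open>has_quotient_dim\<close> computes the
  dimension of the corresponding quotient of spaces of germs.\<close>

definition holomorphic_germs :: "complex^'m \<Rightarrow> (complex^'m \<Rightarrow> complex) set" where
  "holomorphic_germs w = {f. \<exists>U. open U \<and> w \<in> U \<and> holomorphic_mv f U}"

definition germ_ideal ::
    "complex^'m \<Rightarrow> (complex^'m \<Rightarrow> complex) set \<Rightarrow> (complex^'m \<Rightarrow> complex) set" where
  "germ_ideal w G = {f. \<exists>(N::nat) a h. (\<forall>k<N. a k \<in> holomorphic_germs w \<and> h k \<in> G) \<and>
     (\<forall>\<^sub>F z in nhds w. f z = (\<Sum>k<N. a k z * h k z))}"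

definition stalk :: "('m::finite) hmodule \<Rightarrow> complex^'m \<Rightarrow> (complex^'m \<Rightarrow> complex) set" where
  "stalk M w = germ_ideal w (hcarrier M)"

definition minimal_generators ::
    "complex^'m \<Rightarrow> (complex^'m \<Rightarrow> complex) set \<Rightarrow> ('t \<Rightarrow> complex^'m \<Rightarrow> complex) \<Rightarrow> bool" where
  "minimal_generators w S g \<longleftrightarrow> germ_ideal w (range g) = S \<and>
     (\<forall>J. J \<noteq> UNIV \<longrightarrow> germ_ideal w (g ` J) \<noteq> S)"

section \<open>Decomposition of the reproducing kernel\<close>

text \<open>Anti-holomorphic maps into \<open>M\<close>, in the sense of a conjugate-linear Frechet derivative with
  respect to the norm of \<open>M\<close>.\<close>

definition antiholomorphic_into ::
    "('m::finite) hmodule \<Rightarrow> (complex^'m \<Rightarrow> complex^'m \<Rightarrow> complex) \<Rightarrow> (complex^'m) set \<Rightarrow> bool" where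
  "antiholomorphic_into M F S \<longleftrightarrow> (\<forall>w\<in>S. F w \<in> hcarrier M) \<and>
     (\<forall>w\<in>S. \<exists>D. (\<forall>v. D v \<in> hcarrier M) \<and>
        (\<forall>u v. D (u + v) = (\<lambda>z. D u z + D v z)) \<and>
        (\<forall>c v. D (c *s v) = (\<lambda>z. cnj c * D v z)) \<and>
        ((\<lambda>v. hnorm M (\<lambda>z. F (w + v) z - F w z - D v z) / norm v) \<longlongrightarrow> 0) (at 0))"

text \<open>\<open>Kj j w\<close> stands for \<open>K\<^bsup>(j)\<^esup>(\<cdot>,w)\<close>.\<close>

definition kernel_decomposition ::
    "('m::finite) hmodule \<Rightarrow> (complex^'m \<Rightarrow> complex^'m \<Rightarrow> complex) \<Rightarrow>
     ('t::finite \<Rightarrow> complex^'m \<Rightarrow> complex) \<Rightarrow> (complex^'m) set \<Rightarrow>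
     ('t \<Rightarrow> complex^'m \<Rightarrow> complex^'m \<Rightarrow> complex) \<Rightarrow> bool" where
  "kernel_decomposition M K g \<Delta> Kj \<longleftrightarrow>
     (\<forall>j. holomorphic_mv (g j) \<Delta>) \<and>
     (\<forall>j. antiholomorphic_into M (Kj j) \<Delta>) \<and>
     (\<forall>w\<in>\<Delta>. \<forall>c::'t \<Rightarrow> complex. (\<lambda>z. \<Sum>j\<in>UNIV. c j * Kj j w z) = (\<lambda>z. 0) \<longrightarrow> (\<forall>j. c j = 0)) \<and>
     (\<forall>w\<in>\<Delta>. (\<lambda>z. K z w) = (\<lambda>z. \<Sum>j\<in>UNIV. cnj (g j w) * Kj j w z))"

section \<open>Hermitian holomorphic line bundles and the bundle on the exceptional fibre\<close>

text \<open>A Hermitian holomorphic line bundle with base points in \<open>'b\<close> and fibres that are lines of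
  functions on \<open>'x\<close>. The base is covered by charts indexed by \<open>'t\<close>; \<open>hb_point i\<close> is the
  inverse of the \<open>i\<close>-th chart and \<open>hb_frame i\<close> is a holomorphic frame over this chart, both as
  functions of the coordinates. Charts of a projective space have one coordinate for each index
  \<open>j \<noteq> i\<close>; the component \<open>i\<close> of the coordinate vector is a dummy on which neither depends.\<close>

record ('b, 'x, 't) hermitian_line_bundle =
  hb_base :: "'b set"
  hb_point :: "'t \<Rightarrow> complex^'t \<Rightarrow> 'b"
  hb_fibre :: "'b \<Rightarrow> ('x \<Rightarrow> complex) set"
  hb_frame :: "'t \<Rightarrow> complex^'t \<Rightarrow> 'x \<Rightarrow> complex"
  hb_metric :: "'b \<Rightarrow> ('x \<Rightarrow> complex) \<Rightarrow> ('x \<Rightarrow> complex) \<Rightarrow> complex"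

text \<open>Isometric holomorphic bundle isomorphism over the identity. Holomorphy of \<open>\<Phi>\<close> is holomorphy of
  its matrix coefficients \<open>h\<close> with respect to the holomorphic frames; \<open>h\<close> does not vanish as \<open>\<Phi>\<close> is
  bijective, so the inverse is holomorphic as well.\<close>

definition bundle_equivalent ::
    "('b, 'x, 't::finite) hermitian_line_bundle \<Rightarrow> ('b, 'y, 't) hermitian_line_bundle \<Rightarrow> bool" where
  "bundle_equivalent E F \<longleftrightarrow> hb_base E = hb_base F \<and> hb_point E = hb_point F \<and>
     (\<exists>\<Phi>. (\<forall>b\<in>hb_base E.
            bij_betw (\<Phi> b) (hb_fibre E b) (hb_fibre F b) \<and>
            (\<forall>x y. \<forall>f\<in>hb_fibre E b. \<forall>g\<in>hb_fibre E b.
               \<Phi> b (\<lambda>z. x * f z + y * g z) = (\<lambda>z. x * \<Phi> b f z + y * \<Phi> b g z)) \<and>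
            (\<forall>f\<in>hb_fibre E b. \<forall>g\<in>hb_fibre E b.
               hb_metric F b (\<Phi> b f) (\<Phi> b g) = hb_metric E b f g)) \<and>
          (\<forall>i. \<exists>h. holomorphic_mv h UNIV \<and>
             (\<forall>\<tau>. \<Phi> (hb_point E i \<tau>) (hb_frame E i \<tau>) = (\<lambda>z. h \<tau> * hb_frame F i \<tau> z))))"

text \<open>Points of projective space are lines through the origin.\<close>

definition proj_point :: "complex^'t \<Rightarrow> (complex^'t) set" where
  "proj_point u = range (\<lambda>c. c *s u)"

definition proj_space :: "(complex^'t) set set" where
  "proj_space = proj_point ` {u. u \<noteq> 0}"

definition exc_fibre :: "complex^'m \<Rightarrow> ((complex^'m) \<times> (complex^'t) set) set" where
  "exc_fibre w = {w} \<times> proj_space"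

definition exc_fibre_conj :: "complex^'m \<Rightarrow> ((complex^'m) \<times> (complex^'t) set) set" where
  "exc_fibre_conj w =
     {(cnj_vec w, proj_point (cnj_vec u)) | u. (w, proj_point u) \<in> exc_fibre w}"

definition affine_coords :: "'t \<Rightarrow> complex^'t \<Rightarrow> complex^'t" where
  "affine_coords i u = (\<chi> j. u $ j / u $ i)"

definition frame_s ::
    "('t::finite \<Rightarrow> 'x \<Rightarrow> complex) \<Rightarrow> 't \<Rightarrow> complex^'t \<Rightarrow> 'x \<Rightarrow> complex" where
  "frame_s k i \<theta> = (\<lambda>z. k i z + (\<Sum>j\<in>UNIV - {i}. cnj (\<theta> $ j) * k j z))"

text \<open>The bundle of \<open>M\<close> at \<open>w\<close>, where \<open>k j\<close> is the vector \<open>K\<^bsup>(j)\<^esup>(\<cdot>,w)\<close>. The holomorphic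
  coordinates on the base are \<open>\<tau> = cnj_vec \<theta>\<close>.\<close>

definition bundle_L0 ::
    "('m::finite) hmodule \<Rightarrow> complex^'m \<Rightarrow> ('t::finite \<Rightarrow> complex^'m \<Rightarrow> complex) \<Rightarrow>
     ((complex^'m) \<times> (complex^'t) set, complex^'m, 't) hermitian_line_bundle" where
  "bundle_L0 M w k = \<lparr>
     hb_base = exc_fibre_conj w,
     hb_point = (\<lambda>i \<tau>. (cnj_vec w, proj_point (\<chi> j. if j = i then 1 else \<tau> $ j))),
     hb_fibre = (\<lambda>b. {(\<lambda>z. c * frame_s k i (affine_coords i u) z) | c i u.
                       u $ i \<noteq> 0 \<and> b = (cnj_vec w, proj_point (cnj_vec u))}),
     hb_frame = (\<lambda>i \<tau>. frame_s k i (cnj_vec \<tau>)),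
     hb_metric = (\<lambda>b. hip M)\<rparr>"

end

theory Submission
  imports Defs "HOL-Complex_Analysis.Meromorphic"
begin

text \<open>
  Let \<open>U\<close> be a unitary module map from \<open>M\<close> to \<open>M'\<close>. The claim follows once \<open>U\<close> maps every
  \<open>K\<^bsup>(j)\<^esup>(\<cdot>,w0)\<close> to the same non-zero multiple of its counterpart in \<open>M'\<close>: then \<open>U\<close> itself, restricted
  to the fibres, is an isometric bundle isomorphism whose matrix coefficients in the frames are
  constant.

  Such a relation comes from writing \<open>U\<close> near \<open>w0\<close> as multiplication by a holomorphic function
  \<open>\<psi>\<close>. If \<open>p\<close> and \<open>q\<close> lie in the ideal, then \<open>p U(q) = U(p q) = q U(p)\<close>; the ideal being dense and
  evaluations being continuous, \<open>p U(f) = f N\<close> for all \<open>f\<close> in \<open>M\<close>, with \<open>N = U(p)\<close>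
  (\<open>quotient_relation\<close>). So \<open>\<psi>\<close> has to be the quotient \<open>N / p\<close>, for any \<open>p\<close> in the ideal that is not
  zero on \<open>\<Omega>\<close>, and what has to be shown is that it has no singularity at \<open>w0\<close>, although \<open>p\<close> and all
  other elements of the ideal vanish there.

  The common generators \<open>g\<close> give this. Both kernels at \<open>z\<close> are the combinations of linearly
  independent vectors, continuous in \<open>z\<close>, with the same coefficients \<open>g\<close>, so their norms are both
  comparable to \<open>|g(z)|\<close>; as \<open>U\<close> relates the two kernels through \<open>N / p\<close>, this quotient
  is bounded near \<open>w0\<close> (\<open>quotient_bound\<close>, where test vectors replace the norms). By a
  several-variable form of Riemann's extension theorem (\<open>bounded_quotient_extends\<close>) it extends
  holomorphically to \<open>w0\<close>, and \<open>U(f) = \<psi> f\<close> on a neighbourhood (\<open>local_multiplier\<close>).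

  Expanding \<open>U(f)\<close> and \<open>\<psi> f\<close> in the two kernel decompositions then gives a linear relation between
  the generators with holomorphic coefficients, and by minimality all its coefficients vanish at
  \<open>w0\<close> (\<open>minimal_generators_relation\<close>), as otherwise one generator could be solved for. That
  is the required relation between the vectors at \<open>w0\<close>
  (\<open>decomposition_vectors_proportional\<close>).
\<close>

(* The dollar sign is also the notation for coefficients of formal power series; below it always
   denotes components of vectors. *)
no_notation fps_nth (infixl "$" 75)

section \<open>Holomorphic functions of several variables\<close>

lemma bounded_linear_smult_left: "bounded_linear (\<lambda>c::complex. c *s (v::complex^'m))"
  unfolding linear_conv_bounded_linear[symmetric]
  by (rule linearI) (simp_all add: vec_eq_iff algebra_simps)

lemma continuous_on_smult_left [continuous_intros]:
  "continuous_on A c \<Longrightarrow> continuous_on A (\<lambda>x. c x *s (v::complex^'m))"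
  by (rule bounded_linear.continuous_on[OF bounded_linear_smult_left])

lemma norm_smult: "norm (c *s (v::complex^'m)) = cmod c * norm v"
  by (simp add: norm_vec_def norm_mult L2_set_right_distrib)

lemma holomorphic_mv_subset: "holomorphic_mv f S \<Longrightarrow> T \<subseteq> S \<Longrightarrow> holomorphic_mv f T"
  unfolding holomorphic_mv_def by blast

lemma holomorphic_mv_continuous_on: "holomorphic_mv f S \<Longrightarrow> continuous_on S f"
  unfolding holomorphic_mv_def continuous_on_eq_continuous_within
  by (meson continuous_at_imp_continuous_within has_derivative_continuous)

lemma holomorphic_mv_const: "holomorphic_mv (\<lambda>z. c) S"
  unfolding holomorphic_mv_def by (auto intro!: exI[of _ "\<lambda>_. 0"])

lemma holomorphic_mv_add:
  "holomorphic_mv f S \<Longrightarrow> holomorphic_mv h S \<Longrightarrow> holomorphic_mv (\<lambda>z. f z + h z) S"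
  unfolding holomorphic_mv_def
proof safe
  fix z assume *: "\<forall>z\<in>S. \<exists>D. (f has_derivative D) (at z) \<and> (\<forall>c v. D (c *s v) = c * D v)"
    "\<forall>z\<in>S. \<exists>D. (h has_derivative D) (at z) \<and> (\<forall>c v. D (c *s v) = c * D v)" "z \<in> S"
  then obtain D D' where "(f has_derivative D) (at z)" "\<And>c v. D (c *s v) = c * D v"
    "(h has_derivative D') (at z)" "\<And>c v. D' (c *s v) = c * D' v" by meson
  then show "\<exists>D. ((\<lambda>z. f z + h z) has_derivative D) (at z) \<and> (\<forall>c v. D (c *s v) = c * D v)"
    by (intro exI[of _ "\<lambda>v. D v + D' v"])
       (auto intro!: derivative_eq_intros simp: algebra_simps)
qed

lemma holomorphic_mv_mult:
  "holomorphic_mv f S \<Longrightarrow> holomorphic_mv h S \<Longrightarrow> holomorphic_mv (\<lambda>z. f z * h z) S"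
  unfolding holomorphic_mv_def
proof safe
  fix z assume *: "\<forall>z\<in>S. \<exists>D. (f has_derivative D) (at z) \<and> (\<forall>c v. D (c *s v) = c * D v)"
    "\<forall>z\<in>S. \<exists>D. (h has_derivative D) (at z) \<and> (\<forall>c v. D (c *s v) = c * D v)" "z \<in> S"
  then obtain D D' where "(f has_derivative D) (at z)" "\<And>c v. D (c *s v) = c * D v"
    "(h has_derivative D') (at z)" "\<And>c v. D' (c *s v) = c * D' v" by meson
  then show "\<exists>D. ((\<lambda>z. f z * h z) has_derivative D) (at z) \<and> (\<forall>c v. D (c *s v) = c * D v)"
    by (intro exI[of _ "\<lambda>v. f z * D' v + D v * h z"])
       (auto intro!: derivative_eq_intros simp: algebra_simps)
qed

lemma holomorphic_mv_diff:
  assumes "holomorphic_mv f S" "holomorphic_mv h S"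
  shows "holomorphic_mv (\<lambda>z. f z - h z) S"
  using holomorphic_mv_add[OF assms(1) holomorphic_mv_mult[OF holomorphic_mv_const[of "-1"] assms(2)]]
  by simp

lemma holomorphic_mv_inverse:
  assumes "holomorphic_mv f S" "\<And>z. z \<in> S \<Longrightarrow> f z \<noteq> 0"
  shows "holomorphic_mv (\<lambda>z. inverse (f z)) S"
  unfolding holomorphic_mv_def
proof
  fix z assume z: "z \<in> S"
  then obtain D where D: "(f has_derivative D) (at z)" "\<And>c v. D (c *s v) = c * D v"
    using assms(1) unfolding holomorphic_mv_def by meson
  show "\<exists>D. ((\<lambda>z. inverse (f z)) has_derivative D) (at z) \<and> (\<forall>c v. D (c *s v) = c * D v)"
    by (intro exI[of _ "\<lambda>v. - (inverse (f z) * D v * inverse (f z))"])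
       (use D assms(2)[OF z] in \<open>auto intro!: derivative_eq_intros simp: algebra_simps\<close>)
qed

lemma holomorphic_mv_divide:
  assumes "holomorphic_mv f S" "holomorphic_mv h S" "\<And>z. z \<in> S \<Longrightarrow> h z \<noteq> 0"
  shows "holomorphic_mv (\<lambda>z. f z / h z) S"
  using holomorphic_mv_mult[OF assms(1) holomorphic_mv_inverse[OF assms(2,3)]]
  by (simp add: divide_inverse)

lemma holomorphic_mv_polyfun: "p \<in> polyfuns \<Longrightarrow> holomorphic_mv p UNIV"
proof (induction rule: polyfuns.induct)
  case (coord i)
  show ?case unfolding holomorphic_mv_def
    by (auto intro!: exI[of _ "\<lambda>v. v $ i"] bounded_linear_imp_has_derivative bounded_linear_vec_nth)
qed (auto intro: holomorphic_mv_const holomorphic_mv_add holomorphic_mv_mult)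

lemma open_polydisc: "open (polydisc (w::complex^'m) r)"
proof -
  have "polydisc w r = (\<Inter>i\<in>UNIV. {z. cmod (z $ i - w $ i) < r})"
    by (auto simp: polydisc_def)
  moreover have "open {z::complex^'m. cmod (z $ i - w $ i) < r}" for i
    by (intro open_Collect_less continuous_intros)
  ultimately show ?thesis by (simp add: open_INT)
qed

text \<open>The one-variable theory enters through restriction to complex lines.\<close>

lemma holomorphic_mv_slice_deriv:
  fixes f :: "complex^'m \<Rightarrow> complex"
  assumes "(f has_derivative D) (at (w + \<zeta> *s v))" "\<And>c u. D (c *s u) = c * D u"
  shows "((\<lambda>\<zeta>. f (w + \<zeta> *s v)) has_field_derivative D v) (at \<zeta>)"
proof -
  have "((\<lambda>\<zeta>. w + \<zeta> *s v) has_derivative (\<lambda>\<zeta>. \<zeta> *s v)) (at \<zeta>)"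
    using has_derivative_add[OF has_derivative_const[of w]
        bounded_linear_imp_has_derivative[OF bounded_linear_smult_left[of v]]] by simp
  from has_derivative_compose[OF this assms(1)] show ?thesis
    by (simp add: has_field_derivative_def assms(2) mult_commute_abs)
qed

lemma holomorphic_mv_slice:
  assumes "holomorphic_mv f S" "\<And>\<zeta>. \<zeta> \<in> T \<Longrightarrow> w + \<zeta> *s v \<in> S"
  shows "(\<lambda>\<zeta>. f (w + \<zeta> *s v)) holomorphic_on T"
  unfolding holomorphic_on_def
proof
  fix \<zeta> assume "\<zeta> \<in> T"
  then obtain D where "(f has_derivative D) (at (w + \<zeta> *s v))" "\<And>c u. D (c *s u) = c * D u"
    using assms unfolding holomorphic_mv_def by meson
  from holomorphic_mv_slice_deriv[OF this]
  show "(\<lambda>\<zeta>. f (w + \<zeta> *s v)) field_differentiable at \<zeta> within T"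
    by (meson field_differentiable_def has_field_derivative_at_within)
qed

lemma circle_mean_value:
  assumes "f holomorphic_on ball 0 d" "0 < e" "e < d"
  shows "integral {0..1} (\<lambda>t. f (circlepath 0 e t)) = f 0"
proof -
  have "continuous_on (cball 0 e) f" "f holomorphic_on ball 0 e"
    using assms by (auto intro!: holomorphic_on_imp_continuous_on elim: holomorphic_on_subset)
  from contour_integral_unique[OF Cauchy_integral_circlepath[OF this, of 0]]
  have "contour_integral (circlepath 0 e) (\<lambda>u. f u / u) = 2 * of_real pi * \<i> * f 0"
    using assms by simp
  moreover have "contour_integral (circlepath 0 e) (\<lambda>u. f u / u) =
      integral {0..1} (\<lambda>t. 2 * of_real pi * \<i> * f (circlepath 0 e t))"
    unfolding contour_integral_integral vector_derivative_circlepath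
    using assms by (intro integral_cong) (simp add: circlepath)
  ultimately show ?thesis by simp
qed

lemma circle_deriv:
  assumes "f holomorphic_on ball 0 d" "0 < e" "e < d" "(f has_field_derivative f') (at 0)"
  shows "f' = integral {0..1} (\<lambda>t. f (circlepath 0 e t) / circlepath 0 e t)"
proof -
  have "continuous_on (cball 0 e) f" "f holomorphic_on ball 0 e"
    using assms by (auto intro!: holomorphic_on_imp_continuous_on elim: holomorphic_on_subset)
  from Cauchy_derivative_integral_circlepath(2)[OF this, of 0] assms(2)
  have "f' = 1 / (2 * of_real pi * \<i>) * contour_integral (circlepath 0 e) (\<lambda>u. f u / u^2)"
    using DERIV_unique[OF assms(4)] by simp
  moreover have "contour_integral (circlepath 0 e) (\<lambda>u. f u / u^2) =
      integral {0..1} (\<lambda>t. 2 * of_real pi * \<i> * (f (circlepath 0 e t) / circlepath 0 e t))"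
    unfolding contour_integral_integral vector_derivative_circlepath
    using assms by (intro integral_cong) (simp add: circlepath power2_eq_square field_simps)
  ultimately show ?thesis unfolding integral_mult_right by simp
qed

lemma continuous_on_circlepath_compose [continuous_intros]:
  "continuous_on A h \<Longrightarrow> continuous_on A (\<lambda>x. circlepath z e (h x))"
  unfolding circlepath by (intro continuous_intros)

text \<open>Holomorphy is defined by pointwise differentiability. Continuity of the derivative, which
  differentiation under the integral sign requires, follows from Cauchy's formula: the derivative in
  direction \<open>v\<close> is an integral over a circle in this direction, and its integrand is continuous
  in the centre.\<close>

lemma holomorphic_mv_continuous_derivative:
  fixes f :: "complex^'m \<Rightarrow> complex"
  assumes "open S" "holomorphic_mv f S"
  obtains f' :: "complex^'m \<Rightarrow> (complex^'m) \<Rightarrow>\<^sub>L complex"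
  where "\<And>z. z \<in> S \<Longrightarrow> (f has_derivative blinfun_apply (f' z)) (at z)"
    "\<And>z c v. z \<in> S \<Longrightarrow> f' z (c *s v) = c * f' z v" "continuous_on S f'"
proof -
  obtain D where D: "\<And>z. z \<in> S \<Longrightarrow> (f has_derivative D z) (at z)"
      "\<And>z c v. z \<in> S \<Longrightarrow> D z (c *s v) = c * D z v"
    using assms(2) unfolding holomorphic_mv_def by metis
  define f' where "f' = (\<lambda>z. Blinfun (D z))"
  have f': "blinfun_apply (f' z) = D z" if "z \<in> S" for z
    unfolding f'_def by (rule bounded_linear_Blinfun_apply[OF has_derivative_bounded_linear[OF D(1)[OF that]]])
  have "continuous_on S (\<lambda>z. f' z v)" for v
  proof (rule continuous_at_imp_continuous_on, rule)
    fix z0 assume "z0 \<in> S"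
    then obtain \<rho> where \<rho>: "\<rho> > 0" "ball z0 (2*\<rho>) \<subseteq> S"
      using assms(1) openE by (metis field_sum_of_halves mult_2 half_gt_zero)
    \<comment> \<open>The summand 1 covers the case of a zero direction.\<close>
    define d where "d = \<rho> / (norm v + 1)"
    define e where "e = d / 2"
    have d: "d > 0" "d * norm v \<le> \<rho>"
      using \<rho> by (auto simp: d_def field_simps add_pos_nonneg add_nonneg_eq_0_iff)
    have e: "0 < e" "e < d" using d by (auto simp: e_def)
    have inS: "z + \<zeta> *s v \<in> S" if "z \<in> ball z0 \<rho>" "cmod \<zeta> \<le> d" for z \<zeta>
    proof -
      have "norm (\<zeta> *s v) \<le> \<rho>"
        using that(2) d(2) mult_right_mono[of "cmod \<zeta>" d "norm v"] by (simp add: norm_smult)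
      then have "dist z0 (z + \<zeta> *s v) < 2 * \<rho>"
        using that(1) norm_triangle_ineq4[of "z0 - z" "\<zeta> *s v"] by (simp add: dist_norm algebra_simps)
      then show ?thesis using \<rho> by auto
    qed
    have eq: "f' z v = integral {0..1} (\<lambda>t. f (z + circlepath 0 e t *s v) / circlepath 0 e t)"
      if "z \<in> ball z0 \<rho>" for z
    proof -
      have "z \<in> S" using inS[OF that, of 0] d by simp
      then show ?thesis
        unfolding f'[OF \<open>z \<in> S\<close>]
        by (intro circle_deriv[where d = d] e holomorphic_mv_slice[OF assms(2)] holomorphic_mv_slice_deriv)
           (use inS[OF that] D in auto)
    qed
    have circ: "cmod (circlepath 0 e t) = e" for t
      using e by (simp add: circlepath norm_mult)
  have circ0: "circlepath 0 e t \<noteq> 0" for t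
    using e by (simp add: circlepath)
    have "continuous_on (ball z0 \<rho>) (\<lambda>z. integral (cbox 0 1)
             (\<lambda>t. f (z + circlepath 0 e t *s v) / circlepath 0 e t))"
    proof (rule integral_continuous_on_param)
      have 1: "continuous_on (ball z0 \<rho> \<times> cbox 0 1) (\<lambda>x. circlepath 0 e (snd x))"
        by (intro continuous_intros)
      have "continuous_on (ball z0 \<rho> \<times> cbox 0 1) (\<lambda>x. fst x + circlepath 0 e (snd x) *s v)"
        by (intro continuous_intros 1)
      then have "continuous_on (ball z0 \<rho> \<times> cbox 0 1) (\<lambda>x. f (fst x + circlepath 0 e (snd x) *s v))"
        by (rule continuous_on_compose2[OF holomorphic_mv_continuous_on[OF assms(2)]])
           (use inS circ e in auto)
      then show "continuous_on (ball z0 \<rho> \<times> cbox 0 1)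
          (\<lambda>(z, t). f (z + circlepath 0 e t *s v) / circlepath 0 e t)"
        unfolding case_prod_beta
        by (intro continuous_on_divide 1) (use circ0 in auto)
    qed
    then have "continuous_on (ball z0 \<rho>) (\<lambda>z. f' z v)"
      by (subst continuous_on_cong[OF refl eq]) auto
    then show "isCont (\<lambda>z. f' z v) z0"
      using \<rho> by (simp add: continuous_on_eq_continuous_at)
  qed
  then have "continuous_on S f'" by (rule continuous_on_blinfun_componentwise)
  then show ?thesis using that f' D by metis
qed

text \<open>Differentiation under the integral sign: the derivative of the mean is the mean of the
  derivatives, hence complex linear.\<close>

lemma holomorphic_mv_circle_mean:
  fixes q :: "complex^'m \<Rightarrow> complex"
  assumes "open S" "holomorphic_mv q S"
    and inS: "\<And>w t. w \<in> ball w0 d \<Longrightarrow> t \<in> {0..1} \<Longrightarrow> w + circlepath 0 e t *s v \<in> S"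
  shows "holomorphic_mv (\<lambda>w. integral {0..1} (\<lambda>t. q (w + circlepath 0 e t *s v))) (ball w0 d)"
proof -
  obtain q' :: "complex^'m \<Rightarrow> (complex^'m) \<Rightarrow>\<^sub>L complex" where q':
    "\<And>z. z \<in> S \<Longrightarrow> (q has_derivative blinfun_apply (q' z)) (at z)"
    "\<And>z c v. z \<in> S \<Longrightarrow> q' z (c *s v) = c * q' z v" "continuous_on S q'"
    using holomorphic_mv_continuous_derivative[OF assms(1,2)] by blast
  have cont1: "continuous_on (ball w0 d \<times> cbox 0 1) (\<lambda>x. fst x + circlepath 0 e (snd x) *s v)"
    by (intro continuous_intros)
  have cont2: "continuous_on {0..1} (\<lambda>t. w + circlepath 0 e t *s v)" for w
    by (intro continuous_intros)
  show ?thesis unfolding holomorphic_mv_def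
  proof
    fix w assume w: "w \<in> ball w0 d"
    let ?D = "integral (cbox 0 1) (\<lambda>t. q' (w + circlepath 0 e t *s v))"
    have "((\<lambda>w. integral (cbox 0 1) (\<lambda>t. q (w + circlepath 0 e t *s v))) has_derivative
        blinfun_apply ?D) (at w within ball w0 d)"
    proof (rule leibniz_rule)
      fix x t assume *: "x \<in> ball w0 d" "t \<in> cbox (0::real) 1"
      have "((\<lambda>x. x + circlepath 0 e t *s v) has_derivative (\<lambda>x. x)) (at x within ball w0 d)"
        by (auto intro!: derivative_eq_intros)
      from has_derivative_compose[OF this, of q "blinfun_apply (q' (x + circlepath 0 e t *s v))"]
      show "((\<lambda>x. q (x + circlepath 0 e t *s v)) has_derivative
          blinfun_apply (q' (x + circlepath 0 e t *s v))) (at x within ball w0 d)"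
        using q'(1) inS * by auto
    next
      fix x assume *: "x \<in> ball w0 d"
      show "(\<lambda>t. q (x + circlepath 0 e t *s v)) integrable_on cbox 0 1"
        by (intro integrable_continuous continuous_on_compose2[OF holomorphic_mv_continuous_on[OF assms(2)]])
           (use cont2 inS * in auto)
    next
      show "continuous_on (ball w0 d \<times> cbox 0 1) (\<lambda>(x, t). q' (x + circlepath 0 e t *s v))"
        unfolding case_prod_beta
        by (rule continuous_on_compose2[OF q'(3) cont1]) (use inS in auto)
    qed (use w in auto)
    then have "((\<lambda>w. integral {0..1} (\<lambda>t. q (w + circlepath 0 e t *s v))) has_derivative
        blinfun_apply ?D) (at w)"
      by (simp only: at_within_open[OF w open_ball] cbox_interval)
    moreover have "?D (c *s u) = c * ?D u" for c u
    proof -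
      have int: "(\<lambda>t. q' (w + circlepath 0 e t *s v)) integrable_on cbox 0 1"
        by (intro integrable_continuous continuous_on_compose2[OF q'(3)])
           (use cont2 inS w in auto)
      show ?thesis
        unfolding blinfun_apply_integral[OF int]
        by (subst integral_mult_right[symmetric], rule integral_cong) (use q'(2) inS w in auto)
    qed
    ultimately show "\<exists>D. ((\<lambda>w. integral {0..1} (\<lambda>t. q (w + circlepath 0 e t *s v))) has_derivative D) (at w)
        \<and> (\<forall>c v. D (c *s v) = c * D v)" by blast
  qed
qed

section \<open>Riemann extension of a bounded quotient\<close>

text \<open>The zeros of \<open>P\<close> are isolated, and each of them is a removable singularity of the quotient by
  Riemann's theorem. At the zeros of \<open>P\<close> the product formula holds because the bound forces
  \<open>N\<close> to vanish there too.\<close>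

lemma bounded_quotient_extends_one_variable:
  fixes P N :: "complex \<Rightarrow> complex"
  assumes "open T" "connected T" "P holomorphic_on T" "N holomorphic_on T" "b \<in> T" "P b \<noteq> 0"
    and bound: "\<And>z. z \<in> T \<Longrightarrow> cmod (N z) \<le> C * cmod (P z)"
  obtains \<psi> where "\<psi> holomorphic_on T" "\<And>z. z \<in> T \<Longrightarrow> P z \<noteq> 0 \<Longrightarrow> \<psi> z = N z / P z"
    "\<And>z. z \<in> T \<Longrightarrow> N z = \<psi> z * P z"
proof -
  define q where "q = (\<lambda>z. N z / P z)"
  have an: "q analytic_on {z}" if z: "z \<in> T" "P z \<noteq> 0" for z
  proof -
    have "P analytic_on T" "N analytic_on T"
      using assms(1,3,4) by (simp_all add: analytic_on_open)
    then have "P analytic_on {z}" "N analytic_on {z}"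
      using z analytic_on_subset by blast+
    then show ?thesis unfolding q_def using z by (auto intro!: analytic_intros)
  qed
  have loc: "remove_sings q analytic_on {z}" if z: "z \<in> T" for z
  proof -
    have "\<forall>\<^sub>F w in at z. P w \<noteq> 0 \<and> w \<in> T"
      using non_zero_neighbour_alt[OF assms(3,1,2) z assms(5,6)] .
    then obtain \<delta> where \<delta>: "\<delta> > 0" "\<And>w. w \<noteq> z \<Longrightarrow> dist w z < \<delta> \<Longrightarrow> P w \<noteq> 0 \<and> w \<in> T"
      unfolding eventually_at by auto
    have sub: "ball z \<delta> - {z} \<subseteq> T" "w \<in> ball z \<delta> - {z} \<Longrightarrow> P w \<noteq> 0" for w
      using \<delta>(2) by (force simp: dist_commute)+
    have hol: "q holomorphic_on ball z \<delta> - {z}"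
      unfolding q_def
      by (intro holomorphic_on_divide holomorphic_on_subset[OF assms(3) sub(1)]
          holomorphic_on_subset[OF assms(4) sub(1)] sub(2))
    have "cmod (q w) \<le> C" if "w \<noteq> z" "dist w z < \<delta>" for w
      using bound[of w] \<delta>(2)[OF that] by (simp add: q_def norm_divide field_simps)
    then have "\<forall>\<^sub>F w in at z. cmod (q w) \<le> C"
      unfolding eventually_at using \<delta>(1) by auto
    moreover have "z \<in> interior (ball z \<delta>)" using \<delta>(1) by (simp add: interior_open)
    ultimately obtain h where h: "h holomorphic_on ball z \<delta>" "\<And>w. w \<in> ball z \<delta> - {z} \<Longrightarrow> h w = q w"
      using holomorphic_on_extend_bounded[OF hol] by blast
    have "isCont h z"
      using holomorphic_on_imp_continuous_on[OF h(1)] \<delta>(1)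
      by (simp add: continuous_on_eq_continuous_at)
    then have "h \<midarrow>z\<rightarrow> h z" by (simp add: isCont_def)
    then have "q \<midarrow>z\<rightarrow> h z"
      by (rule Lim_transform_within_open[of _ _ _ _ "ball z \<delta>"]) (use h \<delta> in auto)
    moreover have "isolated_singularity_at q z"
      unfolding isolated_singularity_at_def using hol \<delta>(1)
      by (intro exI[of _ \<delta>]) (simp add: analytic_on_open open_delete)
    ultimately show ?thesis by (rule remove_sings_analytic_at[rotated])
  qed
  then have hol: "remove_sings q holomorphic_on T"
    using analytic_on_analytic_at[of "remove_sings q" T] by (simp add: analytic_imp_holomorphic)
  have 1: "remove_sings q z = N z / P z" if "z \<in> T" "P z \<noteq> 0" for z
    using remove_sings_at_analytic[OF an[OF that]] by (simp add: q_def)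
  have 2: "N z = remove_sings q z * P z" if "z \<in> T" for z
    using bound[OF that] 1[OF that] by (cases "P z = 0") auto
  show ?thesis using that hol 1 2 by blast
qed

text \<open>On the line from \<open>w\<close> to \<open>z1\<close>, the function \<open>p\<close> does not vanish identically, so its zeros
  there are isolated.\<close>

lemma entire_nonzero_punctured:
  assumes "holomorphic_mv p UNIV" "p z1 \<noteq> 0"
  obtains \<delta> where "\<delta> > 0" "\<And>\<zeta>. \<zeta> \<noteq> 0 \<Longrightarrow> cmod \<zeta> < \<delta> \<Longrightarrow> p (w + \<zeta> *s (z1 - w)) \<noteq> 0"
proof -
  have "(\<lambda>\<zeta>. p (w + \<zeta> *s (z1 - w))) holomorphic_on UNIV"
    by (rule holomorphic_mv_slice[OF assms(1)]) auto
  from non_zero_neighbour_alt[OF this, of 0 1] assms(2)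
  have "\<forall>\<^sub>F \<zeta> in at 0. p (w + \<zeta> *s (z1 - w)) \<noteq> 0" by (simp add: connected_UNIV)
  then show ?thesis using that unfolding eventually_at by auto
qed

lemma entire_nonzero_dense:
  assumes "holomorphic_mv p UNIV" "p z1 \<noteq> 0"
  shows "closure {z. p z \<noteq> 0} = (UNIV :: (complex^'m) set)"
proof -
  have "w \<in> closure {z. p z \<noteq> 0}" for w
  proof -
    obtain \<delta> where \<delta>: "\<delta> > 0" "\<And>\<zeta>. \<zeta> \<noteq> 0 \<Longrightarrow> cmod \<zeta> < \<delta> \<Longrightarrow> p (w + \<zeta> *s (z1 - w)) \<noteq> 0"
      using entire_nonzero_punctured[OF assms, of w] by blast
    have lim: "((\<lambda>\<zeta>. w + \<zeta> *s (z1 - w)) \<longlongrightarrow> w + 0 *s (z1 - w)) (at 0)"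
      by (intro tendsto_intros bounded_linear.tendsto[OF bounded_linear_smult_left])
    have "\<forall>\<^sub>F \<zeta> in at 0. w + \<zeta> *s (z1 - w) \<in> {z. p z \<noteq> 0}"
      unfolding eventually_at using \<delta> by auto
    then have "\<forall>\<^sub>F \<zeta> in at 0. w + \<zeta> *s (z1 - w) \<in> closure {z. p z \<noteq> 0}"
      by (rule eventually_mono) (rule subsetD[OF closure_subset])
    from Lim_in_closed_set[OF closed_closure this _ lim] show ?thesis by simp
  qed
  then show ?thesis by auto
qed

text \<open>On the line from \<open>w0\<close> to \<open>z1\<close> the zeros of \<open>p\<close> are isolated, so \<open>p\<close> has no zeros on a small
  circle around \<open>w0\<close> in this line, nor on nearby translates of the circle. On each of the
  translated discs the quotient extends by the one-variable theorem, and its value at the centre is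
  its mean over the circle. This mean involves the quotient only where \<open>p\<close> does not vanish, and it
  is holomorphic in the centre.\<close>

lemma bounded_quotient_extends:
  fixes p N :: "complex^'m \<Rightarrow> complex"
  assumes p: "holomorphic_mv p UNIV" "p z1 \<noteq> 0"
    and "open S" "w0 \<in> S" "holomorphic_mv N S"
    and bound: "\<And>z. z \<in> S \<Longrightarrow> cmod (N z) \<le> C * cmod (p z)"
  obtains W \<psi> where "open W" "w0 \<in> W" "W \<subseteq> S" "holomorphic_mv \<psi> W"
    "\<And>z. z \<in> W \<Longrightarrow> N z = \<psi> z * p z"
proof -
  obtain \<rho> where \<rho>: "\<rho> > 0" "ball w0 (2*\<rho>) \<subseteq> S"
    using assms(3,4) openE by (metis field_sum_of_halves mult_2 half_gt_zero)
  define v where "v = z1 - w0"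
  obtain \<delta> where \<delta>: "\<delta> > 0" "\<And>\<zeta>. \<zeta> \<noteq> 0 \<Longrightarrow> cmod \<zeta> < \<delta> \<Longrightarrow> p (w0 + \<zeta> *s v) \<noteq> 0"
    using entire_nonzero_punctured[OF p, of w0] unfolding v_def by blast
  \<comment> \<open>The first bound keeps the circle off the zeros of \<open>p\<close>, the second one keeps the discs inside
    the domain of \<open>N\<close>.\<close>
  define d where "d = min \<delta> (\<rho> / (norm v + 1))"
  define e where "e = d / 2"
  have d: "d > 0" "d \<le> \<delta>" "d * norm v \<le> \<rho>"
  proof -
    have "norm v + 1 > 0" by (simp add: add_nonneg_pos)
    then show "d > 0" "d \<le> \<delta>" using \<rho> \<delta> by (auto simp: d_def)
    have "d * norm v \<le> \<rho> / (norm v + 1) * norm v" by (intro mult_right_mono) (simp_all add: d_def)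
    also have "\<dots> \<le> \<rho>" using \<rho> \<open>norm v + 1 > 0\<close> by (simp add: field_simps)
    finally show "d * norm v \<le> \<rho>" .
  qed
  have e: "0 < e" "e < d" using d by (auto simp: e_def)
  have inS: "z + \<zeta> *s v \<in> S" if "z \<in> ball w0 \<rho>" "cmod \<zeta> \<le> d" for z \<zeta>
  proof -
    have "norm (\<zeta> *s v) \<le> \<rho>"
      using that(2) d(3) mult_right_mono[of "cmod \<zeta>" d "norm v"] by (simp add: norm_smult)
    then have "dist w0 (z + \<zeta> *s v) < 2 * \<rho>"
      using that(1) norm_triangle_ineq4[of "w0 - z" "\<zeta> *s v"] by (simp add: dist_norm algebra_simps)
    then show ?thesis using \<rho> by auto
  qed
  have circ: "cmod (circlepath 0 e t) = e" for t
    using e by (simp add: circlepath norm_mult)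
  have circ0: "circlepath 0 e t \<noteq> 0" for t
    using e by (simp add: circlepath)
  define O' where "O' = {z \<in> S. p z \<noteq> 0}"
  have "open O'"
    unfolding O'_def using open_Collect_neq[OF holomorphic_mv_continuous_on[OF p(1)], of "\<lambda>_. 0"] assms(3)
    by (auto simp: Collect_conj_eq)
  define A where "A = (\<lambda>t. w0 + circlepath 0 e t *s v) ` {0..1}"
  have "compact A" unfolding A_def
    by (intro compact_continuous_image continuous_intros) auto
  moreover have "A \<subseteq> O'"
    unfolding A_def O'_def using inS[of w0] circ circ0 e d \<rho> \<delta>(2) by auto
  ultimately obtain \<epsilon> where \<epsilon>: "\<epsilon> > 0" "(\<Union>x\<in>A. ball x \<epsilon>) \<subseteq> O'"
    using compact_subset_open_imp_ball_epsilon_subset \<open>open O'\<close> by metis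
  define W where "W = ball w0 (min \<epsilon> \<rho>)"
  have WO: "w + circlepath 0 e t *s v \<in> O'" if "w \<in> W" "t \<in> {0..1}" for w t
  proof -
    have "w + circlepath 0 e t *s v \<in> ball (w0 + circlepath 0 e t *s v) \<epsilon>"
      using that by (simp add: W_def dist_norm)
    then show ?thesis using \<epsilon>(2) that(2) unfolding A_def by blast
  qed
  define \<psi> where "\<psi> = (\<lambda>w. integral {0..1} (\<lambda>t. N (w + circlepath 0 e t *s v) / p (w + circlepath 0 e t *s v)))"
  have "holomorphic_mv (\<lambda>z. N z / p z) O'"
    by (intro holomorphic_mv_divide holomorphic_mv_subset[OF p(1)] holomorphic_mv_subset[OF assms(5)])
       (auto simp: O'_def)
  then have "holomorphic_mv \<psi> W"
    unfolding \<psi>_def W_def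
    by (rule holomorphic_mv_circle_mean[OF \<open>open O'\<close>]) (use WO in \<open>auto simp: W_def\<close>)
  moreover have "N z = \<psi> z * p z" if z: "z \<in> W" for z
  proof -
    let ?P = "\<lambda>\<zeta>. p (z + \<zeta> *s v)" and ?N = "\<lambda>\<zeta>. N (z + \<zeta> *s v)"
    have zb: "z \<in> ball w0 \<rho>" using z by (simp add: W_def)
    have P: "?P holomorphic_on ball 0 d"
      by (rule holomorphic_mv_slice[OF p(1)]) simp
    have N: "?N holomorphic_on ball 0 d"
      by (rule holomorphic_mv_slice[OF assms(5)]) (use inS[OF zb] in simp)
    have bd: "cmod (?N \<zeta>) \<le> C * cmod (?P \<zeta>)" if "\<zeta> \<in> ball 0 d" for \<zeta>
      by (rule bound[OF inS[OF zb]]) (use that in simp)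
    have 2: "circlepath 0 e 0 \<in> ball 0 d" "?P (circlepath 0 e 0) \<noteq> 0"
      using WO[OF z, of 0] circ e by (auto simp: O'_def)
    obtain \<eta> where \<eta>: "\<eta> holomorphic_on ball 0 d"
       "\<And>\<zeta>. \<zeta> \<in> ball 0 d \<Longrightarrow> ?P \<zeta> \<noteq> 0 \<Longrightarrow> \<eta> \<zeta> = ?N \<zeta> / ?P \<zeta>"
       "\<And>\<zeta>. \<zeta> \<in> ball 0 d \<Longrightarrow> ?N \<zeta> = \<eta> \<zeta> * ?P \<zeta>"
      using bounded_quotient_extends_one_variable[OF open_ball connected_ball P N 2 bd] by blast
    have "\<psi> z = integral {0..1} (\<lambda>t. \<eta> (circlepath 0 e t))"
      unfolding \<psi>_def
      by (intro integral_cong \<eta>(2)[symmetric]) (use circ e WO[OF z] in \<open>auto simp: O'_def\<close>)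
    also have "\<dots> = \<eta> 0" using circle_mean_value[OF \<eta>(1) e] .
    finally show ?thesis using \<eta>(3)[of 0] d by simp
  qed
  moreover have "open W" "w0 \<in> W" "W \<subseteq> S" using \<rho> \<epsilon> by (auto simp: W_def)
  ultimately show ?thesis using that by blast
qed

section \<open>Ideals of germs\<close>

lemma holomorphic_germs_mult:
  assumes "a \<in> holomorphic_germs w" "b \<in> holomorphic_germs w"
  shows "(\<lambda>z. a z * b z) \<in> holomorphic_germs w"
proof -
  obtain U V where "open U" "w \<in> U" "holomorphic_mv a U" "open V" "w \<in> V" "holomorphic_mv b V"
    using assms unfolding holomorphic_germs_def by blast
  then show ?thesis unfolding holomorphic_germs_def
    by (intro CollectI exI[of _ "U \<inter> V"])
       (auto intro!: holomorphic_mv_mult elim: holomorphic_mv_subset)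
qed

lemma germ_ideal_cong:
  assumes "f \<in> germ_ideal w G" "\<forall>\<^sub>F z in nhds w. h z = f z"
  shows "h \<in> germ_ideal w G"
proof -
  obtain N :: nat and a u where u: "\<forall>k<N. a k \<in> holomorphic_germs w \<and> u k \<in> G"
    "\<forall>\<^sub>F z in nhds w. f z = (\<Sum>k<N. a k z * u k z)"
    using assms(1) unfolding germ_ideal_def by blast
  have "\<forall>\<^sub>F z in nhds w. h z = (\<Sum>k<N. a k z * u k z)"
    using assms(2) u(2) by eventually_elim simp
  then show ?thesis using u(1) unfolding germ_ideal_def by blast
qed

lemma germ_ideal_zero: "(\<lambda>z. 0) \<in> germ_ideal w G"
  unfolding germ_ideal_def by (auto intro!: exI[of _ "0::nat"])

lemma germ_ideal_add_generator:
  assumes "f \<in> germ_ideal w G" "b \<in> holomorphic_germs w" "v \<in> G"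
  shows "(\<lambda>z. f z + b z * v z) \<in> germ_ideal w G"
proof -
  obtain N :: nat and a u where u: "\<forall>k<N. a k \<in> holomorphic_germs w \<and> u k \<in> G"
    "\<forall>\<^sub>F z in nhds w. f z = (\<Sum>k<N. a k z * u k z)"
    using assms(1) unfolding germ_ideal_def by blast
  have "\<forall>\<^sub>F z in nhds w. f z + b z * v z = (\<Sum>k<Suc N. (a(N := b)) k z * (u(N := v)) k z)"
    using u(2) by eventually_elim simp
  moreover have "\<forall>k<Suc N. (a(N := b)) k \<in> holomorphic_germs w \<and> (u(N := v)) k \<in> G"
    using u(1) assms(2,3) by (auto simp: less_Suc_eq)
  ultimately show ?thesis unfolding germ_ideal_def by blast
qed

lemma germ_ideal_linear_combination:
  fixes b :: "'t::finite \<Rightarrow> complex^'m \<Rightarrow> complex"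
  assumes "\<And>i. i \<in> J \<Longrightarrow> b i \<in> holomorphic_germs w \<and> u i \<in> G"
  shows "(\<lambda>z. \<Sum>i\<in>J. b i z * u i z) \<in> germ_ideal w G"
proof -
  have "finite J" by simp
  then show ?thesis using assms
  proof (induction J)
    case (insert i J)
    then show ?case
      using germ_ideal_add_generator[of "\<lambda>z. \<Sum>i\<in>J. b i z * u i z" w G "b i" "u i"]
      by (simp add: add.commute)
  qed (simp add: germ_ideal_zero)
qed

lemma germ_ideal_add_multiple:
  assumes "f \<in> germ_ideal w G" "h \<in> germ_ideal w G" "c \<in> holomorphic_germs w"
  shows "(\<lambda>z. f z + c z * h z) \<in> germ_ideal w G"
proof -
  obtain N :: nat and a u where u: "\<forall>k<N. a k \<in> holomorphic_germs w \<and> u k \<in> G"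
    "\<forall>\<^sub>F z in nhds w. h z = (\<Sum>k<N. a k z * u k z)"
    using assms(2) unfolding germ_ideal_def by blast
  have "(\<lambda>z. f z + c z * (\<Sum>k<n. a k z * u k z)) \<in> germ_ideal w G" if "n \<le> N" for n
    using that
  proof (induction n)
    case (Suc n)
    then show ?case
      using germ_ideal_add_generator[of "\<lambda>z. f z + c z * (\<Sum>k<n. a k z * u k z)" w G
          "\<lambda>z. c z * a n z" "u n"] holomorphic_germs_mult[OF assms(3)] u(1)
      by (simp add: algebra_simps)
  qed (simp add: assms(1))
  then have *: "(\<lambda>z. f z + c z * (\<Sum>k<N. a k z * u k z)) \<in> germ_ideal w G" by simp
  have "\<forall>\<^sub>F z in nhds w. f z + c z * h z = f z + c z * (\<Sum>k<N. a k z * u k z)"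
    using u(2) by eventually_elim simp
  with * show ?thesis by (rule germ_ideal_cong)
qed

lemma germ_ideal_subset:
  assumes "G \<subseteq> germ_ideal w H"
  shows "germ_ideal w G \<subseteq> germ_ideal w H"
proof
  fix f assume "f \<in> germ_ideal w G"
  then obtain N :: nat and a u where u: "\<forall>k<N. a k \<in> holomorphic_germs w \<and> u k \<in> G"
    "\<forall>\<^sub>F z in nhds w. f z = (\<Sum>k<N. a k z * u k z)"
    unfolding germ_ideal_def by blast
  have "(\<lambda>z. \<Sum>k<n. a k z * u k z) \<in> germ_ideal w H" if "n \<le> N" for n
    using that
  proof (induction n)
    case (Suc n)
    then have "u n \<in> germ_ideal w H" "a n \<in> holomorphic_germs w"
      using u(1) assms by auto
    with Suc show ?case
      using germ_ideal_add_multiple[of "\<lambda>z. \<Sum>k<n. a k z * u k z" w H "u n" "a n"] by simp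
  qed (simp add: germ_ideal_zero)
  from germ_ideal_cong[OF this[OF order_refl] u(2)] show "f \<in> germ_ideal w H" .
qed

text \<open>If \<open>a j\<close> did not vanish at \<open>w\<close>, it could be inverted near \<open>w\<close>, and the relation could be
  solved for \<open>g j\<close>: the other generators would suffice.\<close>

lemma minimal_generators_relation:
  fixes g :: "'t::finite \<Rightarrow> complex^'m \<Rightarrow> complex"
  assumes gen: "minimal_generators w S g"
    and W: "open W" "w \<in> W" and hol: "\<And>j. holomorphic_mv (a j) W"
    and rel: "\<And>z. z \<in> W \<Longrightarrow> (\<Sum>j\<in>UNIV. g j z * a j z) = 0"
  shows "a j w = 0"
proof (rule ccontr)
  assume nz: "a j w \<noteq> 0"
  define J where "J = UNIV - {j}"
  define V where "V = {z \<in> W. a j z \<noteq> 0}"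
  have V: "open V" "w \<in> V"
    unfolding V_def using nz W continuous_open_preimage[OF holomorphic_mv_continuous_on[OF hol[of j]] W(1), of "- {0}"]
    by (auto simp: vimage_def Int_def)
  have b: "(\<lambda>z. - (a i z / a j z)) \<in> holomorphic_germs w" for i
  proof -
    have "holomorphic_mv (\<lambda>z. 0 - a i z / a j z) V"
      by (intro holomorphic_mv_diff holomorphic_mv_divide holomorphic_mv_const
          holomorphic_mv_subset[OF hol]) (auto simp: V_def)
    then show ?thesis using V unfolding holomorphic_germs_def by auto
  qed
  have gj: "g j \<in> germ_ideal w (g ` J)"
  proof (rule germ_ideal_cong)
    show "(\<lambda>z. \<Sum>i\<in>J. - (a i z / a j z) * g i z) \<in> germ_ideal w (g ` J)"
      by (rule germ_ideal_linear_combination) (use b in auto)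
    have "g j z = (\<Sum>i\<in>J. - (a i z / a j z) * g i z)" if z: "z \<in> V" for z
    proof -
      have "g j z * a j z + (\<Sum>i\<in>J. g i z * a i z) = 0"
        using rel[of z] z sum.remove[of UNIV j "\<lambda>j. g j z * a j z"] by (simp add: V_def J_def)
      then have "g j z * a j z = a j z * (\<Sum>i\<in>J. - (a i z / a j z) * g i z)"
        using z by (simp add: V_def sum_distrib_left eq_neg_iff_add_eq_0 sum_negf mult.commute)
      then show ?thesis using z by (simp add: V_def)
    qed
    then show "\<forall>\<^sub>F z in nhds w. g j z = (\<Sum>i\<in>J. - (a i z / a j z) * g i z)"
      using V unfolding eventually_nhds by blast
  qed
  have sub: "u \<in> germ_ideal w G" if "u \<in> G" for u G
    using germ_ideal_add_generator[OF germ_ideal_zero _ that, of "\<lambda>_. 1" w]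
    by (auto simp: holomorphic_germs_def intro!: holomorphic_mv_const)
  have "g i \<in> germ_ideal w (g ` J)" for i
    using gj sub[of "g i" "g ` J"] by (cases "i = j") (simp_all add: J_def)
  then have "range g \<subseteq> germ_ideal w (g ` J)" by blast
  then have "germ_ideal w (range g) \<subseteq> germ_ideal w (g ` J)"
    by (rule germ_ideal_subset)
  moreover have "g ` J \<subseteq> germ_ideal w (range g)"
    using sub[of _ "range g"] by auto
  then have "germ_ideal w (g ` J) \<subseteq> germ_ideal w (range g)"
    by (rule germ_ideal_subset)
  ultimately have "germ_ideal w (g ` J) = S"
    using gen unfolding minimal_generators_def by simp
  moreover have "J \<noteq> UNIV" by (auto simp: J_def)
  ultimately show False
    using gen unfolding minimal_generators_def by simp
qed

section \<open>Hilbert spaces of functions\<close>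

context
  fixes \<Omega> :: "(complex^'m) set" and M :: "('m::finite) hmodule"
  assumes H: "hilbert_function_space \<Omega> M"
begin

lemma hcarrier_combine:
  "f \<in> hcarrier M \<Longrightarrow> h \<in> hcarrier M \<Longrightarrow> (\<lambda>z. a * f z + b * h z) \<in> hcarrier M"
  using H unfolding hilbert_function_space_def by blast

lemma hip_combine_left:
  "f \<in> hcarrier M \<Longrightarrow> h \<in> hcarrier M \<Longrightarrow> k \<in> hcarrier M \<Longrightarrow>
    hip M (\<lambda>z. a * f z + b * h z) k = a * hip M f k + b * hip M h k"
  using H unfolding hilbert_function_space_def by blast

lemma hip_cnj: "f \<in> hcarrier M \<Longrightarrow> h \<in> hcarrier M \<Longrightarrow> hip M h f = cnj (hip M f h)"
  using H unfolding hilbert_function_space_def by blast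

lemma hcarrier_zero: "(\<lambda>z. 0) \<in> hcarrier M"
  using H unfolding hilbert_function_space_def by blast

lemma hcarrier_holomorphic: "f \<in> hcarrier M \<Longrightarrow> holomorphic_mv f \<Omega>"
  using H unfolding hilbert_function_space_def by blast

lemma hcarrier_outside: "f \<in> hcarrier M \<Longrightarrow> z \<notin> \<Omega> \<Longrightarrow> f z = 0"
  using H unfolding hilbert_function_space_def by blast

lemma hip_self_pos: "f \<in> hcarrier M \<Longrightarrow> f \<noteq> (\<lambda>z. 0) \<Longrightarrow> Re (hip M f f) > 0"
  using H unfolding hilbert_function_space_def by blast

lemma hcarrier_scale: "f \<in> hcarrier M \<Longrightarrow> (\<lambda>z. c * f z) \<in> hcarrier M"
  using hcarrier_combine[of f f c 0] by simp

lemma hcarrier_add: "f \<in> hcarrier M \<Longrightarrow> h \<in> hcarrier M \<Longrightarrow> (\<lambda>z. f z + h z) \<in> hcarrier M"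
  using hcarrier_combine[of f h 1 1] by simp

lemma hcarrier_diff: "f \<in> hcarrier M \<Longrightarrow> h \<in> hcarrier M \<Longrightarrow> (\<lambda>z. f z - h z) \<in> hcarrier M"
  using hcarrier_combine[of f h 1 "-1"] by simp

lemma hip_scale_left:
  "f \<in> hcarrier M \<Longrightarrow> k \<in> hcarrier M \<Longrightarrow> hip M (\<lambda>z. c * f z) k = c * hip M f k"
  using hip_combine_left[of f f k c 0] by simp

lemma hip_add_left:
  "f \<in> hcarrier M \<Longrightarrow> h \<in> hcarrier M \<Longrightarrow> k \<in> hcarrier M \<Longrightarrow>
    hip M (\<lambda>z. f z + h z) k = hip M f k + hip M h k"
  using hip_combine_left[of f h k 1 1] by simp

lemma hip_diff_left:
  "f \<in> hcarrier M \<Longrightarrow> h \<in> hcarrier M \<Longrightarrow> k \<in> hcarrier M \<Longrightarrow>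
    hip M (\<lambda>z. f z - h z) k = hip M f k - hip M h k"
  using hip_combine_left[of f h k 1 "-1"] by simp

lemma hip_zero_left: "k \<in> hcarrier M \<Longrightarrow> hip M (\<lambda>z. 0) k = 0"
  using hip_scale_left[OF hcarrier_zero, of k 0] by simp

lemma hip_scale_right:
  "f \<in> hcarrier M \<Longrightarrow> k \<in> hcarrier M \<Longrightarrow> hip M k (\<lambda>z. c * f z) = cnj c * hip M k f"
  by (simp add: hip_cnj[of _ k] hip_scale_left hcarrier_scale)

lemma hip_add_right:
  "f \<in> hcarrier M \<Longrightarrow> h \<in> hcarrier M \<Longrightarrow> k \<in> hcarrier M \<Longrightarrow>
    hip M k (\<lambda>z. f z + h z) = hip M k f + hip M k h"
  by (simp add: hip_cnj[of _ k] hip_add_left hcarrier_add)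

lemma hip_diff_right:
  "f \<in> hcarrier M \<Longrightarrow> h \<in> hcarrier M \<Longrightarrow> k \<in> hcarrier M \<Longrightarrow>
    hip M k (\<lambda>z. f z - h z) = hip M k f - hip M k h"
  by (simp add: hip_cnj[of _ k] hip_diff_left hcarrier_diff)

lemma hip_zero_right: "k \<in> hcarrier M \<Longrightarrow> hip M k (\<lambda>z. 0) = 0"
  using hip_scale_right[OF hcarrier_zero, of k 0] by simp

lemma hcarrier_sum:
  assumes "finite A" "\<And>j. j \<in> A \<Longrightarrow> k j \<in> hcarrier M"
  shows "(\<lambda>z. \<Sum>j\<in>A. c j * k j z) \<in> hcarrier M"
  using assms by (induction A) (simp_all add: hcarrier_zero hcarrier_add hcarrier_scale)

lemma hip_sum_left:
  assumes "finite A" "\<And>j. j \<in> A \<Longrightarrow> k j \<in> hcarrier M" "h \<in> hcarrier M"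
  shows "hip M (\<lambda>z. \<Sum>j\<in>A. c j * k j z) h = (\<Sum>j\<in>A. c j * hip M (k j) h)"
  using assms
  by (induction A) (simp_all add: hip_zero_left hip_add_left hcarrier_scale hip_scale_left hcarrier_sum)

lemma hip_sum_right:
  assumes "finite A" "\<And>j. j \<in> A \<Longrightarrow> k j \<in> hcarrier M" "h \<in> hcarrier M"
  shows "hip M h (\<lambda>z. \<Sum>j\<in>A. c j * k j z) = (\<Sum>j\<in>A. cnj (c j) * hip M h (k j))"
  using assms
  by (induction A) (simp_all add: hip_zero_right hip_add_right hcarrier_scale hip_scale_right hcarrier_sum)

lemma hip_self_real: "f \<in> hcarrier M \<Longrightarrow> hip M f f = of_real ((hnorm M f)\<^sup>2)"
  and hnorm_nonneg: "f \<in> hcarrier M \<Longrightarrow> hnorm M f \<ge> 0"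
proof -
  assume f: "f \<in> hcarrier M"
  have "Re (hip M f f) \<ge> 0"
    using hip_self_pos[OF f] hip_zero_left[OF f] by (cases "f = (\<lambda>z. 0)") auto
  moreover have "Im (hip M f f) = 0"
    using hip_cnj[OF f f] by (metis complex_cnj_cancel_iff cnj.simps(2) neg_equal_zero)
  ultimately show "hip M f f = of_real ((hnorm M f)\<^sup>2)" "hnorm M f \<ge> 0"
    by (auto simp: hnorm_def complex_eq_iff)
qed

lemma hip_Cauchy_Schwarz:
  assumes f: "f \<in> hcarrier M" and h: "h \<in> hcarrier M"
  shows "cmod (hip M f h) \<le> hnorm M f * hnorm M h"
proof (cases "h = (\<lambda>z. 0)")
  case True
  then show ?thesis using f h hnorm_nonneg by (simp add: hip_zero_right)
next
  case False
  define s where "s = (hnorm M h)\<^sup>2"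
  have hh: "hip M h h = of_real s" using hip_self_real[OF h] by (simp add: s_def)
  then have s: "s > 0" using hip_self_pos[OF h False] by simp
  \<comment> \<open>The vector \<open>d\<close> is the component of \<open>f\<close> orthogonal to \<open>h\<close>.\<close>
  define l where "l = hip M f h / of_real s"
  define d where "d = (\<lambda>z. f z - l * h z)"
  have lh: "(\<lambda>z. l * h z) \<in> hcarrier M" using hcarrier_scale[OF h] .
  have d: "d \<in> hcarrier M" unfolding d_def using hcarrier_diff[OF f lh] .
  have "hip M d h = 0"
    unfolding d_def hip_diff_left[OF f lh h] hip_scale_left[OF h h] hh using s by (simp add: l_def)
  then have "hip M d d = hip M d f"
    using hip_diff_right[OF f lh d] hip_scale_right[OF h d] by (simp add: d_def)
  also have "\<dots> = hip M f f - l * hip M h f"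
    unfolding d_def using f h lh by (simp add: hip_diff_left hip_scale_left)
  also have "l * hip M h f = of_real ((cmod (hip M f h))\<^sup>2 / s)"
    using hip_cnj[OF f h] complex_norm_square[of "hip M f h"] by (simp add: l_def)
  finally have "of_real ((hnorm M d)\<^sup>2) = (of_real ((hnorm M f)\<^sup>2 - (cmod (hip M f h))\<^sup>2 / s) :: complex)"
    using hip_self_real[OF d] hip_self_real[OF f] by simp
  then have "(hnorm M d)\<^sup>2 = (hnorm M f)\<^sup>2 - (cmod (hip M f h))\<^sup>2 / s"
    by (simp only: of_real_eq_iff)
  then have "(cmod (hip M f h))\<^sup>2 / s \<le> (hnorm M f)\<^sup>2" by (metis diff_ge_0_iff_ge zero_le_power2)
  then have "(cmod (hip M f h))\<^sup>2 \<le> (hnorm M f * hnorm M h)\<^sup>2"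
    using s by (simp add: field_simps s_def)
  then show ?thesis
    by (rule power2_le_imp_le) (simp add: f h hnorm_nonneg)
qed

lemma hip_ext:
  assumes "f \<in> hcarrier M" "k \<in> hcarrier M" "\<And>h. h \<in> hcarrier M \<Longrightarrow> hip M h f = hip M h k"
  shows "f = k"
proof -
  have d: "(\<lambda>z. f z - k z) \<in> hcarrier M" using assms(1,2) by (rule hcarrier_diff)
  have "hip M (\<lambda>z. f z - k z) (\<lambda>z. f z - k z) = 0"
    using assms(3)[OF d] by (simp add: hip_diff_right[OF assms(1,2) d])
  then have "(\<lambda>z. f z - k z) = (\<lambda>z. 0)" using hip_self_pos[OF d] by force
  then show ?thesis by (simp add: fun_eq_iff)
qed

lemma reproducing_kernel_bound:
  assumes "reproducing_kernel \<Omega> M K" "w \<in> \<Omega>" "f \<in> hcarrier M"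
  shows "cmod (f w) \<le> hnorm M f * hnorm M (\<lambda>z. K z w)"
  using hip_Cauchy_Schwarz[OF assms(3), of "\<lambda>z. K z w"] assms
  unfolding reproducing_kernel_def by metis

text \<open>Pairing with a fixed vector turns the conjugate-linear derivative \<open>D\<close> of \<open>F\<close> into a
  complex-linear one, since the inner product is conjugate-linear in its second argument; the error
  term is controlled by the Cauchy-Schwarz inequality.\<close>

lemma antiholomorphic_into_weak:
  assumes F: "antiholomorphic_into M F S" and "open S" and f: "f \<in> hcarrier M"
  shows "holomorphic_mv (\<lambda>w. hip M f (F w)) S"
  unfolding holomorphic_mv_def
proof
  fix w assume w: "w \<in> S"
  have FS: "F w \<in> hcarrier M" if "w \<in> S" for w
    using F that unfolding antiholomorphic_into_def by blast
  have "\<exists>D. (\<forall>v. D v \<in> hcarrier M) \<and>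
        (\<forall>u v. D (u + v) = (\<lambda>z. D u z + D v z)) \<and>
        (\<forall>c v. D (c *s v) = (\<lambda>z. cnj c * D v z)) \<and>
        ((\<lambda>v. hnorm M (\<lambda>z. F (w + v) z - F w z - D v z) / norm v) \<longlongrightarrow> 0) (at 0)"
    using F w unfolding antiholomorphic_into_def by blast
  then obtain D where D: "\<And>v. D v \<in> hcarrier M" "\<And>u v. D (u + v) = (\<lambda>z. D u z + D v z)"
    "\<And>c v. D (c *s v) = (\<lambda>z. cnj c * D v z)"
    "((\<lambda>v. hnorm M (\<lambda>z. F (w + v) z - F w z - D v z) / norm v) \<longlongrightarrow> 0) (at 0)"
    by blast
  define E where "E = (\<lambda>v. hip M f (D v))"
  have E: "E (c *s v) = c * E v" for c v
    unfolding E_def D(3) using D(1) f by (simp add: hip_scale_right)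
  have "c *\<^sub>R v = complex_of_real c *s v" for c and v :: "complex^'m"
    by (simp add: vec_eq_iff complex_eq_iff)
  then have "linear E"
    by (intro linearI) (simp_all add: E scaleR_conv_of_real, simp add: E_def D hip_add_right f)
  then have bl: "bounded_linear E" by (simp add: linear_conv_bounded_linear)
  have "((\<lambda>v. hnorm M f * (hnorm M (\<lambda>z. F (w + v) z - F w z - D v z) / norm v)) \<longlongrightarrow> hnorm M f * 0) (at 0)"
    by (intro tendsto_intros D(4))
  then have lim: "((\<lambda>v. hnorm M f * (hnorm M (\<lambda>z. F (w + v) z - F w z - D v z) / norm v)) \<longlongrightarrow> 0) (at 0)"
    by simp
  have "\<forall>\<^sub>F v in at 0. w + v \<in> S"
  proof -
    have "((\<lambda>v. w + v) \<longlongrightarrow> w + 0) (at 0)" by (intro tendsto_intros)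
    then show ?thesis using topological_tendstoD[OF _ \<open>open S\<close>, of "\<lambda>v. w + v" "w + 0" "at 0"] w by simp
  qed
  then have "\<forall>\<^sub>F v in at 0. norm (norm (hip M f (F (w + v)) - hip M f (F w) - E v) / norm v)
      \<le> hnorm M f * (hnorm M (\<lambda>z. F (w + v) z - F w z - D v z) / norm v)"
  proof eventually_elim
    case (elim v)
    have 1: "(\<lambda>z. F (w + v) z - F w z) \<in> hcarrier M" using hcarrier_diff FS elim w by blast
    have 2: "(\<lambda>z. F (w + v) z - F w z - D v z) \<in> hcarrier M" using hcarrier_diff[OF 1 D(1)] .
    have "hip M f (F (w + v)) - hip M f (F w) - E v = hip M f (\<lambda>z. F (w + v) z - F w z - D v z)"
      by (simp add: E_def hip_diff_right[OF 1 D(1) f] hip_diff_right[OF FS[OF elim] FS[OF w] f])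
    then show ?case using hip_Cauchy_Schwarz[OF f 2] by (simp add: divide_right_mono)
  qed
  then have "((\<lambda>v. norm (hip M f (F (w + v)) - hip M f (F w) - E v) / norm v) \<longlongrightarrow> 0) (at 0)"
    using lim by (rule Lim_null_comparison)
  then have "((\<lambda>w. hip M f (F w)) has_derivative E) (at w)"
    using bl unfolding has_derivative_at by simp
  then show "\<exists>D. ((\<lambda>w. hip M f (F w)) has_derivative D) (at w) \<and> (\<forall>c v. D (c *s v) = c * D v)"
    using E by blast
qed

end

text \<open>Inserting the decomposition into the reproducing property writes every element of \<open>M\<close> in
  terms of the functions \<open>g j\<close>. The coefficients are holomorphic if \<open>\<Delta>\<close> is open, by
  \<open>antiholomorphic_into_weak\<close>.\<close>

lemma kernel_decomposition_eval:
  assumes H: "hilbert_function_space \<Omega> M" and K: "reproducing_kernel \<Omega> M K"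
    and dec: "kernel_decomposition M K g \<Delta> Kj" and w: "w \<in> \<Delta>" "w \<in> \<Omega>" and f: "f \<in> hcarrier M"
  shows "f w = (\<Sum>j\<in>UNIV. g j w * hip M f (Kj j w))"
proof -
  have Kj: "Kj j w \<in> hcarrier M" for j
    using dec w(1) unfolding kernel_decomposition_def antiholomorphic_into_def by blast
  have "f w = hip M f (\<lambda>z. K z w)"
    using K w(2) f unfolding reproducing_kernel_def by simp
  also have "(\<lambda>z. K z w) = (\<lambda>z. \<Sum>j\<in>UNIV. cnj (g j w) * Kj j w z)"
    using dec w(1) unfolding kernel_decomposition_def by blast
  also have "hip M f \<dots> = (\<Sum>j\<in>UNIV. cnj (cnj (g j w)) * hip M f (Kj j w))"
    by (rule hip_sum_right[OF H finite Kj f])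
  also have "\<dots> = (\<Sum>j\<in>UNIV. g j w * hip M f (Kj j w))" by simp
  finally show ?thesis .
qed

section \<open>Sesquilinear forms depending on a parameter\<close>

text \<open>A bound uniform over the unit sphere, so that continuity of the matrix entries in the
  parameter controls the whole form.\<close>

lemma cmod_form_le:
  fixes a :: "complex^'t"
  assumes "norm a = 1"
  shows "cmod (\<Sum>i\<in>UNIV. \<Sum>j\<in>UNIV. cnj (a $ i) * a $ j * X i j) \<le> (\<Sum>i\<in>UNIV. \<Sum>j\<in>UNIV. cmod (X i j))"
proof -
  have "cmod (cnj (a $ i) * a $ j * X i j) \<le> cmod (X i j)" for i j
  proof -
    have "cmod (a $ i) * cmod (a $ j) \<le> 1 * 1"
      using Finite_Cartesian_Product.norm_nth_le[of a] assms by (intro mult_mono) auto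
    then show ?thesis
      using mult_right_mono[of "cmod (a $ i) * cmod (a $ j)" 1 "cmod (X i j)"] by (simp add: norm_mult)
  qed
  then show ?thesis by (intro sum_norm_le)
qed

lemma form_upper_bound:
  fixes B :: "'t::finite \<Rightarrow> 't \<Rightarrow> 'b::topological_space \<Rightarrow> complex"
  assumes "\<And>i j. (B i j \<longlongrightarrow> B i j w) (nhds w)"
  obtains C where "C > 0" "\<forall>\<^sub>F z in nhds w. \<forall>a::complex^'t. norm a = 1 \<longrightarrow>
    cmod (\<Sum>i\<in>UNIV. \<Sum>j\<in>UNIV. cnj (a $ i) * a $ j * B i j z) \<le> C"
proof -
  define s where "s = (\<lambda>z. \<Sum>i\<in>UNIV. \<Sum>j\<in>UNIV. cmod (B i j z))"
  have "(s \<longlongrightarrow> s w) (nhds w)" unfolding s_def by (intro tendsto_intros assms)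
  then have "\<forall>\<^sub>F z in nhds w. s z < s w + 1" by (rule order_tendstoD) simp
  then have "\<forall>\<^sub>F z in nhds w. \<forall>a::complex^'t. norm a = 1 \<longrightarrow>
      cmod (\<Sum>i\<in>UNIV. \<Sum>j\<in>UNIV. cnj (a $ i) * a $ j * B i j z) \<le> s w + 1"
  proof eventually_elim
    case (elim z)
    then show ?case using cmod_form_le[of _ "\<lambda>i j. B i j z"] unfolding s_def by fastforce
  qed
  moreover have "s w + 1 > 0" unfolding s_def by (intro add_nonneg_pos sum_nonneg) auto
  ultimately show ?thesis using that by blast
qed

text \<open>At the parameter \<open>w\<close> the form is bounded below on the unit sphere by compactness, and for
  nearby parameters it differs uniformly little from the form at \<open>w\<close>.\<close>

lemma form_lower_bound:
  fixes B :: "'t::finite \<Rightarrow> 't \<Rightarrow> 'b::topological_space \<Rightarrow> complex"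
  assumes lim: "\<And>i j. (B i j \<longlongrightarrow> B i j w) (nhds w)"
    and pos: "\<And>a::complex^'t. norm a = 1 \<Longrightarrow>
      Re (\<Sum>i\<in>UNIV. \<Sum>j\<in>UNIV. cnj (a $ i) * a $ j * B i j w) > 0"
  obtains c where "c > 0" "\<forall>\<^sub>F z in nhds w. \<forall>a::complex^'t. norm a = 1 \<longrightarrow>
    c \<le> cmod (\<Sum>i\<in>UNIV. \<Sum>j\<in>UNIV. cnj (a $ i) * a $ j * B i j z)"
proof -
  define Q where "Q = (\<lambda>z (a::complex^'t). \<Sum>i\<in>UNIV. \<Sum>j\<in>UNIV. cnj (a $ i) * a $ j * B i j z)"
  have "axis undefined 1 \<in> sphere (0::complex^'t) 1" by simp
  then have "sphere (0::complex^'t) 1 \<noteq> {}" by blast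
  moreover have "continuous_on (sphere 0 1) (\<lambda>a. Re (Q w a))"
    unfolding Q_def by (intro continuous_intros)
  ultimately obtain a0 where a0: "a0 \<in> sphere 0 1" "\<And>a. a \<in> sphere 0 1 \<Longrightarrow> Re (Q w a0) \<le> Re (Q w a)"
    using continuous_attains_inf[of "sphere (0::complex^'t) 1" "\<lambda>a. Re (Q w a)"] by auto
  define c where "c = Re (Q w a0) / 2"
  have c: "c > 0" using pos[of a0] a0(1) by (simp add: c_def Q_def)
  define s where "s = (\<lambda>z. \<Sum>i\<in>UNIV. \<Sum>j\<in>UNIV. cmod (B i j z - B i j w))"
  have "(s \<longlongrightarrow> (\<Sum>i\<in>UNIV. \<Sum>j\<in>UNIV. cmod (B i j w - B i j w))) (nhds w)"
    unfolding s_def by (intro tendsto_intros lim)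
  then have "\<forall>\<^sub>F z in nhds w. s z < c" using c by (intro order_tendstoD) auto
  then have "\<forall>\<^sub>F z in nhds w. \<forall>a::complex^'t. norm a = 1 \<longrightarrow> c \<le> cmod (Q z a)"
  proof (eventually_elim, intro allI impI)
    fix z and a :: "complex^'t" assume z: "s z < c" and a: "norm a = 1"
    have "Q z a - Q w a = (\<Sum>i\<in>UNIV. \<Sum>j\<in>UNIV. cnj (a $ i) * a $ j * (B i j z - B i j w))"
      unfolding Q_def by (simp add: sum_subtractf[symmetric] right_diff_distrib)
    then have "cmod (Q z a - Q w a) \<le> s z"
      using cmod_form_le[OF a, of "\<lambda>i j. B i j z - B i j w"] by (simp add: s_def)
    moreover have "2 * c \<le> cmod (Q w a)"
      using a0(2)[of a] a complex_Re_le_cmod[of "Q w a"] by (simp add: c_def)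
    moreover have "cmod (Q w a) \<le> cmod (Q z a) + cmod (Q z a - Q w a)"
      by (metis norm_triangle_sub norm_minus_commute)
    ultimately show "c \<le> cmod (Q z a)" using z by linarith
  qed
  then show ?thesis using that c unfolding Q_def by blast
qed

section \<open>Unitary module maps\<close>

locale unitary_module_map =
  fixes \<Omega> :: "(complex^'m) set" and M M' :: "('m::finite) hmodule"
    and U :: "(complex^'m \<Rightarrow> complex) \<Rightarrow> complex^'m \<Rightarrow> complex"
  assumes H: "hilbert_function_space \<Omega> M" and H': "hilbert_function_space \<Omega> M'"
    and bij: "bij_betw U (hcarrier M) (hcarrier M')"
    and lin: "\<And>a b f h. f \<in> hcarrier M \<Longrightarrow> h \<in> hcarrier M \<Longrightarrow>
      U (\<lambda>z. a * f z + b * h z) = (\<lambda>z. a * U f z + b * U h z)"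
    and iso: "\<And>f h. f \<in> hcarrier M \<Longrightarrow> h \<in> hcarrier M \<Longrightarrow> hip M' (U f) (U h) = hip M f h"
    and module: "\<And>p f. p \<in> polyfuns \<Longrightarrow> f \<in> hcarrier M \<Longrightarrow> U (\<lambda>z. p z * f z) = (\<lambda>z. p z * U f z)"
begin

lemma U_carrier: "f \<in> hcarrier M \<Longrightarrow> U f \<in> hcarrier M'"
  using bij by (auto simp: bij_betw_def)

lemma U_sum:
  assumes "finite A" "\<And>j. j \<in> A \<Longrightarrow> k j \<in> hcarrier M"
  shows "U (\<lambda>z. \<Sum>j\<in>A. c j * k j z) = (\<lambda>z. \<Sum>j\<in>A. c j * U (k j) z)"
  using assms
proof (induction A)
  case empty
  show ?case using lin[OF hcarrier_zero[OF H] hcarrier_zero[OF H], of 0 0] by simp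
next
  case (insert i A)
  have "(\<lambda>z. \<Sum>j\<in>A. c j * k j z) \<in> hcarrier M"
    using insert by (intro hcarrier_sum[OF H]) auto
  from lin[OF insert.prems[of i] this, of "c i" 1] show ?case using insert by simp
qed

lemma hnorm_U_diff:
  assumes "f \<in> hcarrier M" "h \<in> hcarrier M"
  shows "hnorm M' (\<lambda>z. U f z - U h z) = hnorm M (\<lambda>z. f z - h z)"
proof -
  have "U (\<lambda>z. f z - h z) = (\<lambda>z. U f z - U h z)"
    using lin[OF assms, of 1 "-1"] by simp
  then show ?thesis
    using iso[OF hcarrier_diff[OF H assms] hcarrier_diff[OF H assms]] by (simp add: hnorm_def)
qed

text \<open>If \<open>f\<close> is a polynomial of the ideal, both sides are the value at \<open>w\<close> of the image of the
  product of \<open>p\<close> and \<open>f\<close>, since either factor can be pulled out of \<open>U\<close>. The general case follows by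
  density, as point evaluations are bounded.\<close>

lemma quotient_relation:
  assumes K: "reproducing_kernel \<Omega> M K" and K': "reproducing_kernel \<Omega> M' K'"
    and I: "poly_ideal I" "completion_of \<Omega> I M" "p \<in> I"
    and f: "f \<in> hcarrier M" and w: "w \<in> \<Omega>"
  shows "p w * U f w = f w * U (\<lambda>z. if z \<in> \<Omega> then p z else 0) w"
proof -
  define e where "e = (\<lambda>q z. if z \<in> \<Omega> then q z else (0::complex))"
  have eM: "e q \<in> hcarrier M" if "q \<in> I" for q
    using I(2) that unfolding completion_of_def e_def by blast
  have poly: "q \<in> polyfuns" if "q \<in> I" for q
    using I(1) that unfolding poly_ideal_def by blast
  have ideal: "p w * U (e q) w = q w * U (e p) w" if q: "q \<in> I" for q
  proof -
    have "U (\<lambda>z. p z * e q z) = (\<lambda>z. p z * U (e q) z)"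
      by (rule module[OF poly[OF I(3)] eM[OF q]])
    moreover have "U (\<lambda>z. q z * e p z) = (\<lambda>z. q z * U (e p) z)"
      by (rule module[OF poly[OF q] eM[OF I(3)]])
    moreover have "(\<lambda>z. p z * e q z) = (\<lambda>z. q z * e p z)"
      by (auto simp: e_def)
    ultimately show ?thesis by metis
  qed
  define k k' where "k = hnorm M (\<lambda>z. K z w)" and "k' = hnorm M' (\<lambda>z. K' z w)"
  define L where "L = cmod (p w) * k' + cmod (U (e p) w) * k"
  have kpos: "k \<ge> 0" "k' \<ge> 0"
    using K K' w hnorm_nonneg[OF H] hnorm_nonneg[OF H']
    by (auto simp: k_def k'_def reproducing_kernel_def)
  have est: "cmod (p w * U f w - f w * U (e p) w) \<le> d * L" if "d > 0" for d
  proof -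
    obtain q where q: "q \<in> I" "hnorm M (\<lambda>z. f z - e q z) < d"
      using I(2) f \<open>d > 0\<close> unfolding completion_of_def e_def by blast
    have diff: "(\<lambda>z. f z - e q z) \<in> hcarrier M" "(\<lambda>z. U f z - U (e q) z) \<in> hcarrier M'"
      using hcarrier_diff[OF H f eM[OF q(1)]] hcarrier_diff[OF H' U_carrier[OF f] U_carrier[OF eM[OF q(1)]]]
      by auto
    have 1: "cmod (f w - e q w) \<le> d * k"
    proof -
      have "cmod (f w - e q w) \<le> hnorm M (\<lambda>z. f z - e q z) * k"
        using reproducing_kernel_bound[OF H K w diff(1)] by (simp add: k_def)
      also have "\<dots> \<le> d * k" using q(2) kpos by (intro mult_right_mono) auto
      finally show ?thesis .
    qed
    have 2: "cmod (U f w - U (e q) w) \<le> d * k'"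
    proof -
      have "cmod (U f w - U (e q) w) \<le> hnorm M (\<lambda>z. f z - e q z) * k'"
        using reproducing_kernel_bound[OF H' K' w diff(2)] hnorm_U_diff[OF f eM[OF q(1)]]
        by (simp add: k'_def)
      also have "\<dots> \<le> d * k'" using q(2) kpos by (intro mult_right_mono) auto
      finally show ?thesis .
    qed
    have "e q w = q w" using w by (simp add: e_def)
    then have "p w * U f w - f w * U (e p) w =
        p w * (U f w - U (e q) w) - (f w - e q w) * U (e p) w"
      using ideal[OF q(1)] by (simp add: algebra_simps)
    also have "cmod \<dots> \<le> cmod (p w) * cmod (U f w - U (e q) w) + cmod (f w - e q w) * cmod (U (e p) w)"
      by (rule order_trans[OF norm_triangle_ineq4]) (simp add: norm_mult)
    also have "\<dots> \<le> cmod (p w) * (d * k') + d * k * cmod (U (e p) w)"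
      by (intro add_mono mult_left_mono mult_right_mono 1 2) auto
    also have "\<dots> = d * L" by (simp add: L_def algebra_simps)
    finally show ?thesis .
  qed
  have "L \<ge> 0" using kpos by (simp add: L_def)
  have "cmod (p w * U f w - f w * U (e p) w) \<le> 0 + d" if "d > 0" for d
  proof -
    have "cmod (p w * U f w - f w * U (e p) w) \<le> d / (L + 1) * L"
      using est[of "d / (L + 1)"] that \<open>L \<ge> 0\<close> by simp
    also have "\<dots> \<le> d" using that \<open>L \<ge> 0\<close> by (simp add: field_simps)
    finally show ?thesis by simp
  qed
  then have "cmod (p w * U f w - f w * U (e p) w) \<le> 0" by (rule field_le_epsilon)
  then show ?thesis by (simp add: e_def)
qed

text \<open>Write \<open>g(z) = s a\<close> with \<open>s > 0\<close> and a unit vector \<open>a\<close>. The combination \<open>F a\<close> of the vectors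
  \<open>Kj i w0\<close> with coefficients \<open>cnj (a i)\<close> satisfies \<open>F a z = s q\<close> and \<open>U (F a) z = s q'\<close>, where \<open>q\<close>
  and \<open>q'\<close> are the values at \<open>a\<close> of forms that depend continuously on \<open>z\<close>. The first of these
  forms has for \<open>z = w0\<close> the Gram matrix of linearly independent vectors, so on unit vectors it is
  bounded below for \<open>z\<close> near \<open>w0\<close>. The scale \<open>s\<close>, which has no positive lower bound near zeros of
  \<open>g\<close>, cancels in \<open>p U(F a) = F a N\<close>.\<close>

lemma quotient_bound:
  fixes g :: "'t::finite \<Rightarrow> complex^'m \<Rightarrow> complex"
  assumes K: "reproducing_kernel \<Omega> M K" and K': "reproducing_kernel \<Omega> M' K'"
    and \<Delta>: "open \<Delta>" "\<Delta> \<subseteq> \<Omega>" "w0 \<in> \<Delta>"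
    and dec: "kernel_decomposition M K g \<Delta> Kj" and dec': "kernel_decomposition M' K' g \<Delta> Kj'"
    and N: "N \<in> hcarrier M'"
    and rel: "\<And>f z. f \<in> hcarrier M \<Longrightarrow> z \<in> \<Delta> \<Longrightarrow> p z * U f z = f z * N z"
  obtains S C where "open S" "w0 \<in> S" "S \<subseteq> \<Delta>" "\<And>z. z \<in> S \<Longrightarrow> cmod (N z) \<le> C * cmod (p z)"
proof -
  define k where "k = (\<lambda>i. Kj i w0)"
  have k: "k i \<in> hcarrier M" for i
    using dec \<Delta>(3) unfolding kernel_decomposition_def antiholomorphic_into_def k_def by blast
  define B where "B = (\<lambda>i j z. hip M (k i) (Kj j z))"
  define B' where "B' = (\<lambda>i j z. hip M' (U (k i)) (Kj' j z))"
  have lim: "(B i j \<longlongrightarrow> B i j w0) (nhds w0)" for i j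
  proof -
    have "holomorphic_mv (B i j) \<Delta>" unfolding B_def
      by (rule antiholomorphic_into_weak[OF H _ \<Delta>(1) k])
         (use dec in \<open>simp add: kernel_decomposition_def\<close>)
    from holomorphic_mv_continuous_on[OF this] show ?thesis
      using \<Delta> by (simp add: continuous_on_eq_continuous_at isCont_def tendsto_at_iff_tendsto_nhds)
  qed
  have lim': "(B' i j \<longlongrightarrow> B' i j w0) (nhds w0)" for i j
  proof -
    have "holomorphic_mv (B' i j) \<Delta>" unfolding B'_def
      by (rule antiholomorphic_into_weak[OF H' _ \<Delta>(1) U_carrier[OF k]])
         (use dec' in \<open>simp add: kernel_decomposition_def\<close>)
    from holomorphic_mv_continuous_on[OF this] show ?thesis
      using \<Delta> by (simp add: continuous_on_eq_continuous_at isCont_def tendsto_at_iff_tendsto_nhds)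
  qed
  define F where "F = (\<lambda>(a::complex^'t) z. \<Sum>i\<in>UNIV. cnj (a $ i) * k i z)"
  have F: "F a \<in> hcarrier M" for a
    unfolding F_def by (rule hcarrier_sum[OF H]) (use k in auto)
  have UF: "U (F a) = (\<lambda>z. \<Sum>i\<in>UNIV. cnj (a $ i) * U (k i) z)" for a
    unfolding F_def by (rule U_sum) (use k in auto)
  have pos: "Re (\<Sum>i\<in>UNIV. \<Sum>j\<in>UNIV. cnj (a $ i) * a $ j * B i j w0) > 0" if a: "norm a = 1" for a
  proof -
    have "F a \<noteq> (\<lambda>z. 0)"
    proof
      assume "F a = (\<lambda>z. 0)"
      then have "\<forall>j. cnj (a $ j) = 0"
        using dec \<Delta>(3) unfolding kernel_decomposition_def F_def k_def
        by (elim conjE) (drule bspec, assumption, drule spec[of _ "\<lambda>j. cnj (a $ j)"], simp)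
      then have "a = 0" by (simp add: vec_eq_iff)
      then show False using a by simp
    qed
    then have "Re (hip M (F a) (F a)) > 0" by (rule hip_self_pos[OF H F])
    also have "hip M (F a) (F a) = (\<Sum>i\<in>UNIV. cnj (a $ i) * hip M (k i) (F a))"
      by (subst (1) F_def) (rule hip_sum_left[OF H finite k F])
    also have "\<dots> = (\<Sum>i\<in>UNIV. \<Sum>j\<in>UNIV. cnj (a $ i) * a $ j * B i j w0)"
    proof (rule sum.cong[OF refl])
      fix i
      have "hip M (k i) (F a) = (\<Sum>j\<in>UNIV. cnj (cnj (a $ j)) * hip M (k i) (k j))"
        unfolding F_def by (rule hip_sum_right[OF H finite k k])
      then show "cnj (a $ i) * hip M (k i) (F a) = (\<Sum>j\<in>UNIV. cnj (a $ i) * a $ j * B i j w0)"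
        by (simp add: sum_distrib_left B_def k_def mult.assoc)
    qed
    finally show ?thesis .
  qed
  obtain c where c: "c > 0" "\<forall>\<^sub>F z in nhds w0. \<forall>a::complex^'t. norm a = 1 \<longrightarrow>
    c \<le> cmod (\<Sum>i\<in>UNIV. \<Sum>j\<in>UNIV. cnj (a $ i) * a $ j * B i j z)"
    by (rule form_lower_bound[OF lim pos])
  obtain C where C: "C > 0" "\<forall>\<^sub>F z in nhds w0. \<forall>a::complex^'t. norm a = 1 \<longrightarrow>
    cmod (\<Sum>i\<in>UNIV. \<Sum>j\<in>UNIV. cnj (a $ i) * a $ j * B' i j z) \<le> C"
    by (rule form_upper_bound[OF lim'])
  have "\<forall>\<^sub>F z in nhds w0. z \<in> \<Delta>" using \<Delta> by (simp add: eventually_nhds_in_open)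
  with c(2) C(2) have "\<forall>\<^sub>F z in nhds w0. z \<in> \<Delta> \<and> cmod (N z) \<le> C / c * cmod (p z)"
  proof eventually_elim
    case (elim z)
    define G where "G = (\<chi> i. g i z)"
    define s where "s = norm G"
    show ?case
    proof (cases "G = 0")
      \<comment> \<open>Here every element of \<open>M'\<close>, in particular \<open>N\<close>, vanishes at \<open>z\<close>.\<close>
      case True
      then have "g i z = 0" for i by (simp add: G_def vec_eq_iff)
      then have "N z = 0"
        using kernel_decomposition_eval[OF H' K' dec' _ _ N, of z] elim(3) \<Delta>(2) by auto
      then show ?thesis using elim(3) c(1) C(1) by simp
    next
      case False
      then have s: "s > 0" by (simp add: s_def)
      define a where "a = (1 / of_real s) *s G"
      have a: "norm a = 1" using s by (simp add: a_def norm_smult s_def norm_divide)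
      have ga: "g i z = of_real s * a $ i" for i using s by (simp add: a_def G_def)
      define q where "q = (\<Sum>i\<in>UNIV. \<Sum>j\<in>UNIV. cnj (a $ i) * a $ j * B i j z)"
      define q' where "q' = (\<Sum>i\<in>UNIV. \<Sum>j\<in>UNIV. cnj (a $ i) * a $ j * B' i j z)"
      have z: "z \<in> \<Omega>" using elim(3) \<Delta>(2) by blast
      have Kjz: "Kj j z \<in> hcarrier M" "Kj' j z \<in> hcarrier M'" for j
        using dec dec' elim(3) unfolding kernel_decomposition_def antiholomorphic_into_def by blast+
      have "F a z = (\<Sum>j\<in>UNIV. of_real s * a $ j * hip M (F a) (Kj j z))"
        using kernel_decomposition_eval[OF H K dec elim(3) z F[of a]] by (simp add: ga)
      also have "\<dots> = (\<Sum>j\<in>UNIV. \<Sum>i\<in>UNIV. of_real s * (cnj (a $ i) * a $ j * B i j z))"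
      proof (rule sum.cong[OF refl])
        fix j
        have "hip M (F a) (Kj j z) = (\<Sum>i\<in>UNIV. cnj (a $ i) * hip M (k i) (Kj j z))"
          unfolding F_def by (rule hip_sum_left[OF H finite k Kjz(1)])
        then show "of_real s * a $ j * hip M (F a) (Kj j z) =
            (\<Sum>i\<in>UNIV. of_real s * (cnj (a $ i) * a $ j * B i j z))"
          by (simp add: sum_distrib_left B_def mult_ac)
      qed
      also have "\<dots> = of_real s * q"
        unfolding q_def sum_distrib_left by (rule sum.swap)
      finally have Fz: "F a z = of_real s * q" .
      have "U (F a) z = (\<Sum>j\<in>UNIV. of_real s * a $ j * hip M' (U (F a)) (Kj' j z))"
        using kernel_decomposition_eval[OF H' K' dec' elim(3) z U_carrier[OF F[of a]]] by (simp add: ga)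
      also have "\<dots> = (\<Sum>j\<in>UNIV. \<Sum>i\<in>UNIV. of_real s * (cnj (a $ i) * a $ j * B' i j z))"
      proof (rule sum.cong[OF refl])
        fix j
        have "hip M' (U (F a)) (Kj' j z) = (\<Sum>i\<in>UNIV. cnj (a $ i) * hip M' (U (k i)) (Kj' j z))"
          unfolding UF by (rule hip_sum_left[OF H' finite U_carrier[OF k] Kjz(2)])
        then show "of_real s * a $ j * hip M' (U (F a)) (Kj' j z) =
            (\<Sum>i\<in>UNIV. of_real s * (cnj (a $ i) * a $ j * B' i j z))"
          by (simp add: sum_distrib_left B'_def mult_ac)
      qed
      also have "\<dots> = of_real s * q'"
        unfolding q'_def sum_distrib_left by (rule sum.swap)
      finally have UFz: "U (F a) z = of_real s * q'" .
      have "of_real s * (p z * q') = of_real s * (q * N z)"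
        using rel[OF F elim(3), of a] unfolding Fz UFz by (simp add: mult_ac)
      then have "cmod (p z) * cmod q' = cmod q * cmod (N z)"
        using s by (simp flip: norm_mult)
      moreover have "c \<le> cmod q" "cmod q' \<le> C"
        using elim(1,2) a by (auto simp: q_def q'_def)
      ultimately have "c * cmod (N z) \<le> C * cmod (p z)"
        using mult_right_mono[of c "cmod q" "cmod (N z)"] mult_left_mono[of "cmod q'" C "cmod (p z)"]
        by (simp add: mult.commute)
      then show ?thesis using elim(3) c(1) by (simp add: field_simps)
    qed
  qed
  then obtain S where "open S" "w0 \<in> S" "\<And>z. z \<in> S \<Longrightarrow> z \<in> \<Delta> \<and> cmod (N z) \<le> C / c * cmod (p z)"
    unfolding eventually_nhds by auto
  then show ?thesis using that[of S "C / c"] by blast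
qed

text \<open>Some \<open>p\<close> in the ideal is not zero on \<open>\<Omega>\<close>, because \<open>M\<close> contains the non-zero vectors
  \<open>Kj j w0\<close>. The function \<open>\<psi>\<close> is the extension of \<open>U(p) / p\<close>, so the claim holds where \<open>p\<close> does
  not vanish, and this is a dense set.\<close>

lemma local_multiplier:
  fixes g :: "'t::finite \<Rightarrow> complex^'m \<Rightarrow> complex"
  assumes K: "reproducing_kernel \<Omega> M K" and K': "reproducing_kernel \<Omega> M' K'"
    and \<Delta>: "open \<Delta>" "\<Delta> \<subseteq> \<Omega>" "w0 \<in> \<Delta>"
    and dec: "kernel_decomposition M K g \<Delta> Kj" and dec': "kernel_decomposition M' K' g \<Delta> Kj'"
    and I: "poly_ideal I" "completion_of \<Omega> I M"
  obtains W \<psi> where "open W" "w0 \<in> W" "W \<subseteq> \<Delta>" "holomorphic_mv \<psi> W"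
    "\<And>f z. f \<in> hcarrier M \<Longrightarrow> z \<in> W \<Longrightarrow> U f z = \<psi> z * f z"
proof -
  \<comment> \<open>Any index serves; all the vectors are non-zero by linear independence.\<close>
  define k where "k = Kj undefined w0"
  have k: "k \<in> hcarrier M"
    using dec \<Delta>(3) unfolding kernel_decomposition_def antiholomorphic_into_def k_def by blast
  have "k \<noteq> (\<lambda>z. 0)"
  proof
    assume "k = (\<lambda>z. 0)"
    then have "(\<lambda>z. \<Sum>j\<in>UNIV. (if j = undefined then 1 else 0) * Kj j w0 z) = (\<lambda>z. 0)"
      by (simp add: k_def fun_eq_iff if_distrib[of "\<lambda>x. x * _"] cong: if_cong)
    then have "\<forall>j. (if j = (undefined::'t) then 1 else 0) = (0::complex)"
      using dec \<Delta>(3) unfolding kernel_decomposition_def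
      by (elim conjE) (drule bspec, assumption, erule allE, erule mp)
    from spec[OF this, of undefined] show False by simp
  qed
  then obtain z1 where z1: "k z1 \<noteq> 0" by (auto simp: fun_eq_iff)
  then have z1\<Omega>: "z1 \<in> \<Omega>" using hcarrier_outside[OF H k] by blast
  obtain p where p: "p \<in> I" "p z1 \<noteq> 0"
  proof -
    define b where "b = hnorm M (\<lambda>z. K z z1)"
    have b: "b \<ge> 0" using hnorm_nonneg[OF H] K z1\<Omega> by (auto simp: b_def reproducing_kernel_def)
    have "cmod (k z1) / (b + 1) > 0" using z1 b by simp
    then obtain q where q: "q \<in> I"
      "hnorm M (\<lambda>z. k z - (if z \<in> \<Omega> then q z else 0)) < cmod (k z1) / (b + 1)"
      using I(2) k unfolding completion_of_def by meson
    have d: "(\<lambda>z. k z - (if z \<in> \<Omega> then q z else 0)) \<in> hcarrier M"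
      using hcarrier_diff[OF H k] I(2) q(1) unfolding completion_of_def by blast
    have "cmod (k z1 - q z1) \<le> hnorm M (\<lambda>z. k z - (if z \<in> \<Omega> then q z else 0)) * b"
      using reproducing_kernel_bound[OF H K z1\<Omega> d] z1\<Omega> by (simp add: b_def)
    also have "\<dots> \<le> cmod (k z1) / (b + 1) * b"
      using q(2) b by (intro mult_right_mono) auto
    also have "\<dots> < cmod (k z1)" using z1 b by (simp add: field_simps)
    finally have "q z1 \<noteq> 0" by auto
    then show ?thesis using that q(1) by blast
  qed
  have php: "holomorphic_mv p UNIV"
    using I(1) p(1) holomorphic_mv_polyfun unfolding poly_ideal_def by blast
  define N where "N = U (\<lambda>z. if z \<in> \<Omega> then p z else 0)"
  have N: "N \<in> hcarrier M'"
    unfolding N_def using I(2) p(1) U_carrier unfolding completion_of_def by blast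
  have rel: "p z * U f z = f z * N z" if "f \<in> hcarrier M" "z \<in> \<Delta>" for f z
    unfolding N_def using quotient_relation[OF K K' I p(1) that(1)] that(2) \<Delta>(2) by blast
  obtain S C where S: "open S" "w0 \<in> S" "S \<subseteq> \<Delta>" "\<And>z. z \<in> S \<Longrightarrow> cmod (N z) \<le> C * cmod (p z)"
    using quotient_bound[OF K K' \<Delta> dec dec' N rel] by blast
  have "holomorphic_mv N S"
    using holomorphic_mv_subset[OF hcarrier_holomorphic[OF H' N]] S(3) \<Delta>(2) by blast
  then obtain W \<psi> where W: "open W" "w0 \<in> W" "W \<subseteq> S" "holomorphic_mv \<psi> W"
    "\<And>z. z \<in> W \<Longrightarrow> N z = \<psi> z * p z"
    by (rule bounded_quotient_extends[OF php p(2) S(1,2) _ S(4)]) blast+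
  have "U f z = \<psi> z * f z" if f: "f \<in> hcarrier M" and z: "z \<in> W" for f z
  proof (rule ccontr)
    assume ne: "U f z \<noteq> \<psi> z * f z"
    have sub: "W \<subseteq> \<Omega>" using W(3) S(3) \<Delta>(2) by blast
    have "holomorphic_mv (\<lambda>z. U f z - \<psi> z * f z) W"
      by (intro holomorphic_mv_diff holomorphic_mv_mult W(4)
          holomorphic_mv_subset[OF hcarrier_holomorphic[OF H f] sub]
          holomorphic_mv_subset[OF hcarrier_holomorphic[OF H' U_carrier[OF f]] sub])
    from continuous_open_preimage[OF holomorphic_mv_continuous_on[OF this] W(1) open_Compl[OF closed_singleton[of 0]]]
    have "open (W \<inter> (\<lambda>z. U f z - \<psi> z * f z) -` (- {0}))" (is "open ?V") .
    moreover have "z \<in> ?V" using z ne by simp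
    ultimately have "?V \<inter> {z. p z \<noteq> 0} \<noteq> {}"
      using open_Int_closure_eq_empty[of ?V "{z. p z \<noteq> 0}"] entire_nonzero_dense[OF php p(2)] by blast
    then obtain y where "y \<in> ?V" "p y \<noteq> 0" by blast
    then have y: "y \<in> W" "U f y \<noteq> \<psi> y * f y" "p y \<noteq> 0" by simp_all
    have "p y * U f y = p y * (\<psi> y * f y)"
      using rel[OF f, of y] W(5)[OF y(1)] y(1) W(3) S(3) by (auto simp: mult_ac)
    then show False using y by simp
  qed
  then show ?thesis using that W S(3) by blast
qed

text \<open>Pairing with \<open>f\<close> turns the identity \<open>U(f) = \<psi> f\<close> near \<open>w0\<close> into a relation between the
  generators, whose coefficients therefore vanish at \<open>w0\<close>. As \<open>f\<close> is arbitrary and \<open>U\<close> is onto, this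
  says that \<open>Kj' j w0\<close> is \<open>cnj (\<psi> w0)\<close> times the image of \<open>Kj j w0\<close>; and \<open>\<psi> w0\<close> is not zero as
  otherwise \<open>Kj' j w0\<close> would be.\<close>

lemma decomposition_vectors_proportional:
  fixes g :: "'t::finite \<Rightarrow> complex^'m \<Rightarrow> complex"
  assumes K: "reproducing_kernel \<Omega> M K" and K': "reproducing_kernel \<Omega> M' K'"
    and \<Delta>: "open \<Delta>" "\<Delta> \<subseteq> \<Omega>" "w0 \<in> \<Delta>"
    and dec: "kernel_decomposition M K g \<Delta> Kj" and dec': "kernel_decomposition M' K' g \<Delta> Kj'"
    and I: "poly_ideal I" "completion_of \<Omega> I M"
    and gen: "minimal_generators w0 S g"
  obtains \<beta> where "\<beta> \<noteq> 0" "\<And>j. U (Kj j w0) = (\<lambda>z. \<beta> * Kj' j w0 z)"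
proof -
  obtain W \<psi> where W: "open W" "w0 \<in> W" "W \<subseteq> \<Delta>" "holomorphic_mv \<psi> W"
    "\<And>f z. f \<in> hcarrier M \<Longrightarrow> z \<in> W \<Longrightarrow> U f z = \<psi> z * f z"
    using local_multiplier[OF K K' \<Delta> dec dec' I] by blast
  have kM: "Kj j w0 \<in> hcarrier M" "Kj' j w0 \<in> hcarrier M'" for j
    using dec dec' \<Delta>(3) unfolding kernel_decomposition_def antiholomorphic_into_def by blast+
  have weak: "hip M' (U f) (Kj' j w0) = \<psi> w0 * hip M f (Kj j w0)" if f: "f \<in> hcarrier M" for f j
  proof -
    define a where "a = (\<lambda>j z. hip M' (U f) (Kj' j z) - \<psi> z * hip M f (Kj j z))"
    have "holomorphic_mv (\<lambda>z. hip M f (Kj j z)) \<Delta>" "holomorphic_mv (\<lambda>z. hip M' (U f) (Kj' j z)) \<Delta>" for j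
      using antiholomorphic_into_weak[OF H _ \<Delta>(1) f] antiholomorphic_into_weak[OF H' _ \<Delta>(1) U_carrier[OF f]]
        dec dec' by (simp_all add: kernel_decomposition_def)
    then have "holomorphic_mv (a j) W" for j
      unfolding a_def using W(3)
      by (intro holomorphic_mv_diff holomorphic_mv_mult W(4)) (blast intro: holomorphic_mv_subset)+
    moreover have "(\<Sum>j\<in>UNIV. g j z * a j z) = 0" if z: "z \<in> W" for z
    proof -
      have z': "z \<in> \<Delta>" "z \<in> \<Omega>" using z W(3) \<Delta>(2) by auto
      have "(\<Sum>j\<in>UNIV. g j z * a j z) = U f z - \<psi> z * f z"
        unfolding kernel_decomposition_eval[OF H K dec z' f]
          kernel_decomposition_eval[OF H' K' dec' z' U_carrier[OF f]]
        by (simp add: a_def sum_distrib_left sum_subtractf[symmetric] algebra_simps)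
      then show ?thesis using W(5)[OF f z] by simp
    qed
    ultimately have "a j w0 = 0" by (rule minimal_generators_relation[OF gen W(1,2)])
    then show ?thesis by (simp add: a_def)
  qed
  have vec: "Kj' j w0 = (\<lambda>z. cnj (\<psi> w0) * U (Kj j w0) z)" for j
  proof (rule hip_ext[OF H' kM(2) hcarrier_scale[OF H' U_carrier[OF kM(1)]]])
    fix h assume h: "h \<in> hcarrier M'"
    then obtain f where f: "f \<in> hcarrier M" "h = U f" using bij by (auto simp: bij_betw_def)
    show "hip M' h (Kj' j w0) = hip M' h (\<lambda>z. cnj (\<psi> w0) * U (Kj j w0) z)"
      using weak[OF f(1)] iso[OF f(1) kM(1)] hip_scale_right[OF H' U_carrier[OF kM(1)] h] f(2) by simp
  qed
  have "\<psi> w0 \<noteq> 0"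
  proof
    assume "\<psi> w0 = 0"
    then have "(\<lambda>z. \<Sum>j\<in>UNIV. 1 * Kj' j w0 z) = (\<lambda>z. 0)" using vec by simp
    then have "\<forall>j::'t. (1::complex) = 0"
      using dec' \<Delta>(3) unfolding kernel_decomposition_def
      by (elim conjE) (drule bspec, assumption, erule allE, erule mp)
    then show False by simp
  qed
  then show ?thesis
    using that[of "1 / cnj (\<psi> w0)"] vec by (simp add: fun_eq_iff)
qed

text \<open>The frames are combinations of the \<open>k j\<close> with coefficients that do not depend on the module, so
  \<open>U\<close> takes each frame of the first bundle to \<open>\<beta>\<close> times the corresponding frame of the second, with
  the same \<open>\<beta>\<close> in all charts and at all points.\<close>

lemma bundle_L0_equivalent:
  fixes k k' :: "'t::finite \<Rightarrow> complex^'m \<Rightarrow> complex"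
  assumes k: "\<And>j. k j \<in> hcarrier M" and \<beta>: "\<beta> \<noteq> 0" and Uk: "\<And>j. U (k j) = (\<lambda>z. \<beta> * k' j z)"
  shows "bundle_equivalent (bundle_L0 M w k) (bundle_L0 M' w k')"
proof -
  have frame: "frame_s l i \<theta> = (\<lambda>z. \<Sum>j\<in>UNIV. (if j = i then 1 else cnj (\<theta> $ j)) * l j z)"
    for l :: "'t \<Rightarrow> complex^'m \<Rightarrow> complex" and i \<theta>
    by (rule ext, subst sum.remove[of UNIV i]) (auto simp: frame_s_def intro!: sum.cong)
  have fM: "frame_s k i \<theta> \<in> hcarrier M" for i \<theta>
    unfolding frame by (rule hcarrier_sum[OF H]) (use k in auto)
  have Uf: "U (frame_s k i \<theta>) = (\<lambda>z. \<beta> * frame_s k' i \<theta> z)" for i \<theta>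
    unfolding frame by (subst U_sum) (use k in \<open>simp_all add: Uk sum_distrib_left mult_ac\<close>)
  have Ucf: "U (\<lambda>z. c * frame_s k i \<theta> z) = (\<lambda>z. c * \<beta> * frame_s k' i \<theta> z)" for c i \<theta>
    using lin[OF fM[of i \<theta>] fM[of i \<theta>], of c 0] by (simp add: Uf mult.assoc)
  let ?E = "bundle_L0 M w k" and ?F = "bundle_L0 M' w k'"
  have fib: "hb_fibre ?E b \<subseteq> hcarrier M" for b
    using hcarrier_scale[OF H fM] by (auto simp: bundle_L0_def)
  have img: "U ` hb_fibre ?E b = hb_fibre ?F b" for b
  proof
    show "U ` hb_fibre ?E b \<subseteq> hb_fibre ?F b"
      by (auto simp: bundle_L0_def Ucf) blast
    show "hb_fibre ?F b \<subseteq> U ` hb_fibre ?E b"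
    proof
      fix f assume "f \<in> hb_fibre ?F b"
      then obtain c i u where f: "f = (\<lambda>z. c * frame_s k' i (affine_coords i u) z)"
        "u $ i \<noteq> 0" "b = (cnj_vec w, proj_point (cnj_vec u))"
        by (auto simp: bundle_L0_def)
      have "f = U (\<lambda>z. c / \<beta> * frame_s k i (affine_coords i u) z)"
        unfolding Ucf f(1) using \<beta> by simp
      moreover have "(\<lambda>z. c / \<beta> * frame_s k i (affine_coords i u) z) \<in> hb_fibre ?E b"
        unfolding bundle_L0_def hermitian_line_bundle.select_convs mem_Collect_eq
        using f(2,3) by blast
      ultimately show "f \<in> U ` hb_fibre ?E b" by blast
    qed
  qed
  have inj: "inj_on U (hb_fibre ?E b)" for b
    using bij fib[of b] by (auto simp: bij_betw_def intro: inj_on_subset)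
  show ?thesis
    unfolding bundle_equivalent_def
  proof (intro conjI exI[of _ "\<lambda>b. U"] ballI allI)
    fix b
    show "bij_betw U (hb_fibre ?E b) (hb_fibre ?F b)"
      using img inj by (simp add: bij_betw_def)
    fix f h assume fh: "f \<in> hb_fibre ?E b" "h \<in> hb_fibre ?E b"
    then have "f \<in> hcarrier M" "h \<in> hcarrier M" using fib by blast+
    then show "U (\<lambda>z. x * f z + y * h z) = (\<lambda>z. x * U f z + y * U h z)" for x y
      by (rule lin)
    show "hb_metric ?F b (U f) (U h) = hb_metric ?E b f h"
      using iso \<open>f \<in> hcarrier M\<close> \<open>h \<in> hcarrier M\<close> by (simp add: bundle_L0_def)
  next
    fix i
    show "\<exists>h. holomorphic_mv h UNIV \<and>
        (\<forall>\<tau>. U (hb_frame ?E i \<tau>) = (\<lambda>z. h \<tau> * hb_frame ?F i \<tau> z))"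
      by (intro exI[of _ "\<lambda>_. \<beta>"] conjI holomorphic_mv_const) (simp add: bundle_L0_def Uf)
  qed (simp_all add: bundle_L0_def)
qed

end

theorem theorem3p4:
  fixes \<Omega> :: "(complex^'m) set"
    and M M' :: "('m::finite) hmodule"
    and K K' :: "complex^'m \<Rightarrow> complex^'m \<Rightarrow> complex"
    and w0 :: "complex^'m"
    and g :: "'t::finite \<Rightarrow> complex^'m \<Rightarrow> complex"
    and r :: real
    and Kj Kj' :: "'t \<Rightarrow> complex^'m \<Rightarrow> complex^'m \<Rightarrow> complex"
  assumes "open \<Omega>" and "connected \<Omega>" and "bounded \<Omega>"
    and "class_B1 \<Omega> M" and "class_B1 \<Omega> M'"
    and "analytic_dim (zero_set \<Omega> M) + 2 \<le> CARD('m)"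
    and "analytic_dim (zero_set \<Omega> M') + 2 \<le> CARD('m)"
    and "\<exists>I. poly_ideal I \<and> completion_of \<Omega> I M \<and> completion_of \<Omega> I M'"
    and "w0 \<in> zero_set \<Omega> M"
    and "reproducing_kernel \<Omega> M K" and "reproducing_kernel \<Omega> M' K'"
    and "has_quotient_dim (stalk M w0) (max_ideal_times w0 (stalk M w0)) CARD('t)"
    and "minimal_generators w0 (stalk M w0) g"
    and "r > 0" and "polydisc w0 r \<subseteq> \<Omega>"
    and "kernel_decomposition M K g (polydisc w0 r) Kj"
    and "kernel_decomposition M' K' g (polydisc w0 r) Kj'"
    and "module_equivalent M M'"
  shows "bundle_equivalent (bundle_L0 M w0 (\<lambda>j. Kj j w0)) (bundle_L0 M' w0 (\<lambda>j. Kj' j w0))"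
proof -
  obtain U where "bij_betw U (hcarrier M) (hcarrier M')"
    "\<forall>a b. \<forall>f\<in>hcarrier M. \<forall>g\<in>hcarrier M.
        U (\<lambda>z. a * f z + b * g z) = (\<lambda>z. a * U f z + b * U g z)"
    "\<forall>f\<in>hcarrier M. \<forall>g\<in>hcarrier M. hip M' (U f) (U g) = hip M f g"
    "\<forall>p\<in>polyfuns. \<forall>f\<in>hcarrier M. U (\<lambda>z. p z * f z) = (\<lambda>z. p z * U f z)"
    using assms(18) unfolding module_equivalent_def by blast
  moreover have "hilbert_function_space \<Omega> M" "hilbert_function_space \<Omega> M'"
    using assms(4,5) unfolding class_B1_def hilbert_module_def by auto
  ultimately interpret unitary_module_map \<Omega> M M' U
    by unfold_locales auto
  obtain I where I: "poly_ideal I" "completion_of \<Omega> I M" using assms(8) by blast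
  have w0: "w0 \<in> polydisc w0 r" using \<open>r > 0\<close> by (simp add: polydisc_def)
  obtain \<beta> where \<beta>: "\<beta> \<noteq> 0" "\<And>j. U (Kj j w0) = (\<lambda>z. \<beta> * Kj' j w0 z)"
    using decomposition_vectors_proportional[OF assms(10,11) open_polydisc assms(15) w0
        assms(16,17) I assms(13)] by blast
  have "Kj j w0 \<in> hcarrier M" for j
    using assms(16) w0 unfolding kernel_decomposition_def antiholomorphic_into_def by blast
  then show ?thesis using \<beta> by (rule bundle_L0_equivalent)
qed

end
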